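(* Let $A$ and $B$ be $n\times n$ complex positive semidefinite matrices, and let $f:[0,\infty)\to\mathbb{R}$ be a non-negative concave function with $f(0)=0$. Then $$\delta(f(A+B);A+B)\prec_w\delta(f(A)+f(B);A+B).$$
   Context: For a Hermitian matrix $X$, $f(X)$ is defined by the spectral functional calculus, and $\lambda_1^\downarrow(X)\ge\cdots\ge\lambda_n^\downarrow(X)$ denote its eigenvalues, counted with multiplicity, in non-increasing order. For vectors $x,y\in\mathbb{R}^n$, $x\prec_w y$ means $\sum_{j=1}^k x_j\le\sum_{j=1}^k y_j$ for all $k=1,\dots,n$, with no rearrangement of the entries. For $n\times n$ Hermitian matrices $X,Y$ the vector $\delta(X;Y)=(\delta_1(X;Y),\dots,\delta_n(X;Y))\in\mathbb{R}^n$ is defined by requiring, for all $k=1,\dots,n$, $$\sum_{j=1}^k \delta_j(X;Y) = \lim_{t\to 0^+}\frac1t\sum_{j=1}^k\left(\lambda_j^\downarrow(Y+tX)-\lambda_j^\downarrow(Y)\right)$$ (the one-sided directional derivative at $Y$ in direction $X$ of the sum of the $k$ largest eigenvalues, which is a convex function, so the limit exists). *)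

theory Defs
  imports
    "HOL-Analysis.Convex"
    "HOL-Computational_Algebra.Polynomial"
    "Jordan_Normal_Form.Schur_Decomposition"
begin

definition hermitian_mat :: "complex mat \<Rightarrow> bool" where
  "hermitian_mat X \<longleftrightarrow> square_mat X \<and> mat_adjoint X = X"

definition psd_mat :: "complex mat \<Rightarrow> bool" where
  "psd_mat X \<longleftrightarrow> hermitian_mat X \<and>
     (\<forall>v \<in> carrier_vec (dim_row X). 0 \<le> Re ((X *\<^sub>v v) \<bullet>c v))"

definition unitary_mat :: "nat \<Rightarrow> complex mat \<Rightarrow> bool" where
  "unitary_mat n U \<longleftrightarrow>
     U \<in> carrier_mat n n \<and> mat_adjoint U * U = 1\<^sub>m n \<and> U * mat_adjoint U = 1\<^sub>m n"

definition diagonalized_by :: "complex mat \<Rightarrow> complex mat \<Rightarrow> (nat \<Rightarrow> real) \<Rightarrow> bool" where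
  "diagonalized_by X U d \<longleftrightarrow> unitary_mat (dim_row X) U \<and>
     X = U * mat_diag (dim_row X) (\<lambda>i. complex_of_real (d i)) * mat_adjoint U"

text \<open>Spectral functional calculus for Hermitian X: if \<open>X = U diag(d) U\<^sup>*\<close>
  with U unitary, then \<open>f(X) = U diag(f(d)) U\<^sup>*\<close>. Independence of the choice of U and d is
  shown in \<open>fun_calc_eqI\<close>; existence of a diagonalization is the spectral theorem.\<close>

definition fun_calc :: "(real \<Rightarrow> real) \<Rightarrow> complex mat \<Rightarrow> complex mat" where
  "fun_calc f X = (THE Y. \<exists>U d. diagonalized_by X U d \<and>
     Y = U * mat_diag (dim_row X) (\<lambda>i. complex_of_real (f (d i))) * mat_adjoint U)"

text \<open>The eigenvalues with algebraic multiplicity in non-increasing order. For Hermitian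
  matrices they are real, so that applying \<open>Re\<close> loses nothing. Entry j of this list, like
  entry j of a vector, is the (j+1)-st in one-based counting; sums over the first k entries are
  therefore sums over \<open>j < k\<close>.\<close>

definition eigvals_desc :: "complex mat \<Rightarrow> real list" where
  "eigvals_desc X = rev (sorted_list_of_multiset (image_mset Re (proots (char_poly X))))"

definition is_delta :: "complex mat \<Rightarrow> complex mat \<Rightarrow> real vec \<Rightarrow> bool" where
  "is_delta X Y d \<longleftrightarrow> d \<in> carrier_vec (dim_row Y) \<and>
     (\<forall>k \<in> {1..dim_row Y}.
        ((\<lambda>t. 1 / t * (\<Sum>j<k. (eigvals_desc (Y + complex_of_real t \<cdot>\<^sub>m X) ! j - eigvals_desc Y ! j)))
           \<longlongrightarrow> (\<Sum>j<k. d $ j)) (at_right 0))"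

definition delta :: "complex mat \<Rightarrow> complex mat \<Rightarrow> real vec" where
  "delta X Y = (THE d. is_delta X Y d)"

text \<open>Comparison of the partial sums of the entries in the given order, without rearrangement.\<close>

definition partial_sums_le :: "real vec \<Rightarrow> real vec \<Rightarrow> bool" (infix \<open>\<prec>\<^sub>w\<close> 50) where
  "x \<prec>\<^sub>w y \<longleftrightarrow> dim_vec x = dim_vec y \<and>
     (\<forall>k \<in> {1..dim_vec x}. (\<Sum>j<k. x $ j) \<le> (\<Sum>j<k. y $ j))"

lemma fun_calc_eqI:
  assumes "diagonalized_by X U d"
  shows "fun_calc f X =
    U * mat_diag (dim_row X) (\<lambda>i. complex_of_real (f (d i))) * mat_adjoint U"
proof -
  define n where "n = dim_row X"
  let ?D = "\<lambda>d. mat_diag n (\<lambda>i. complex_of_real (d i))"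
  have adj: "mat_adjoint M \<in> carrier_mat n n" if "M \<in> carrier_mat n n" for M :: "complex mat"
    using that by (auto simp: mat_adjoint_def)
  have "V * ?D (f \<circ> e) * mat_adjoint V = U * ?D (f \<circ> d) * mat_adjoint U"
    if "diagonalized_by X V e" for V e
  proof -
    have U: "U \<in> carrier_mat n n" "mat_adjoint U * U = 1\<^sub>m n" "U * mat_adjoint U = 1\<^sub>m n"
        "X = U * ?D d * mat_adjoint U"
      using assms by (auto simp: diagonalized_by_def unitary_mat_def n_def)
    have V: "V \<in> carrier_mat n n" "mat_adjoint V * V = 1\<^sub>m n" "V * mat_adjoint V = 1\<^sub>m n"
        "X = V * ?D e * mat_adjoint V"
      using that by (auto simp: diagonalized_by_def unitary_mat_def n_def)
    note UA = adj[OF U(1)] and VA = adj[OF V(1)]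
    have D: "?D c \<in> carrier_mat n n" for c by simp
    define W where "W = mat_adjoint V * U"
    have W: "W \<in> carrier_mat n n" using U VA by (simp add: W_def)
    note cs = mult_carrier_mat[of _ n n _ n]
    have cancel: "mat_adjoint Q * (P * ?D c * mat_adjoint P) * P = mat_adjoint Q * P * ?D c"
      if "P \<in> carrier_mat n n" "Q \<in> carrier_mat n n" "mat_adjoint P * P = 1\<^sub>m n" for P Q c
    proof -
      note A = adj[OF that(1)] adj[OF that(2)] that D[of c]
      have "mat_adjoint Q * (P * ?D c * mat_adjoint P) * P
          = mat_adjoint Q * (P * ?D c * (mat_adjoint P * P))"
        using A by (simp add: assoc_mult_mat[of _ n n _ n _ n] cs)
      also have "\<dots> = mat_adjoint Q * P * ?D c"
        using A by (simp add: assoc_mult_mat[of _ n n _ n _ n] cs right_mult_one_mat[of _ n n])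
      finally show ?thesis .
    qed
    have "W * ?D d = mat_adjoint V * X * U"
      using cancel[OF U(1) V(1) U(2), of d] U(4) by (simp add: W_def)
    also have "\<dots> = mat_adjoint V * V * ?D e * mat_adjoint V * U"
      using V(4) V(1) VA U(1) D by (simp add: assoc_mult_mat[of _ n n _ n _ n] cs)
    also have "\<dots> = ?D e * W"
      using V VA U(1) D[of e]
      by (simp add: W_def assoc_mult_mat[of _ n n _ n _ n] cs left_mult_one_mat[of _ n n])
    finally have comm: "W * ?D d = ?D e * W" .
    have ent: "W $$ (i,j) * d j = e i * W $$ (i,j)" if "i < n" "j < n" for i j
      using arg_cong[OF comm, of "\<lambda>M. M $$ (i,j)"] that W
      by (simp add: mat_diag_mult_left[OF W] mat_diag_mult_right[OF W])
    have "W * ?D (f \<circ> d) = ?D (f \<circ> e) * W"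
    proof (rule eq_matI)
      fix i j assume "i < dim_row (?D (f \<circ> e) * W)" "j < dim_col (?D (f \<circ> e) * W)"
      hence ij: "i < n" "j < n" using W by (auto simp: mat_diag_def)
      show "(W * ?D (f \<circ> d)) $$ (i,j) = (?D (f \<circ> e) * W) $$ (i,j)"
        using ent[OF ij] ij W
        by (cases "W $$ (i,j) = 0")
           (auto simp: mat_diag_mult_left[OF W] mat_diag_mult_right[OF W])
    qed (use W in \<open>auto simp: mat_diag_def\<close>)
    hence "V * (W * ?D (f \<circ> d)) * mat_adjoint U = V * (?D (f \<circ> e) * W) * mat_adjoint U"
      by simp
    moreover have "V * (mat_adjoint V * U * E) * mat_adjoint U
        = V * mat_adjoint V * (U * E * mat_adjoint U)"
      "V * (E * (mat_adjoint V * U)) * mat_adjoint U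
        = V * E * mat_adjoint V * (U * mat_adjoint U)" if "E \<in> carrier_mat n n" for E
      using U(1) V(1) UA VA that by (simp_all add: assoc_mult_mat[of _ n n _ n _ n] cs)
    ultimately have "V * mat_adjoint V * (U * ?D (f \<circ> d) * mat_adjoint U)
        = V * ?D (f \<circ> e) * mat_adjoint V * (U * mat_adjoint U)"
      by (metis D W_def)
    moreover have "U * ?D (f \<circ> d) * mat_adjoint U \<in> carrier_mat n n"
      by (rule cs[OF cs[OF U(1) D] UA])
    moreover have "V * ?D (f \<circ> e) * mat_adjoint V \<in> carrier_mat n n"
      by (rule cs[OF cs[OF V(1) D] VA])
    ultimately show ?thesis
      unfolding U(3) V(3) by (simp only: left_mult_one_mat right_mult_one_mat)
  qed
  note unique = this[unfolded o_def, folded n_def]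
  show ?thesis
    unfolding fun_calc_def n_def[symmetric]
  proof (rule the_equality)
    show "\<exists>V e. diagonalized_by X V e \<and>
        U * ?D (\<lambda>i. f (d i)) * mat_adjoint U = V * ?D (\<lambda>i. f (e i)) * mat_adjoint V"
      using assms by blast
  next
    fix Y assume "\<exists>V e. diagonalized_by X V e \<and> Y = V * ?D (\<lambda>i. f (e i)) * mat_adjoint V"
    thus "Y = U * ?D (\<lambda>i. f (d i)) * mat_adjoint U"
      by (elim exE conjE) (simp only: unique)
  qed
qed

lemma delta_eqI:
  assumes "is_delta X Y d"
  shows "delta X Y = d"
  unfolding delta_def
proof (rule the_equality[of "is_delta X Y", OF assms])
  fix c assume c: "is_delta X Y c"
  have S: "(\<Sum>j<k. c $ j) = (\<Sum>j<k. d $ j)" if "k \<le> dim_row Y" for k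
  proof (cases "k = 0")
    case False
    hence k: "k \<in> {1..dim_row Y}" using that by auto
    show ?thesis
      using c assms k unfolding is_delta_def
      by (intro tendsto_unique[OF trivial_limit_at_right_real]) blast+
  qed simp
  show "c = d"
  proof (rule eq_vecI)
    fix i assume "i < dim_vec d"
    thus "c $ i = d $ i" using S[of i] S[of "Suc i"] assms by (auto simp: is_delta_def)
  qed (use c assms in \<open>auto simp: is_delta_def\<close>)
qed

end

theory Submission
  imports Defs
begin

text \<open>
  Let \<open>C = A + B\<close> have an orthonormal eigenbasis \<open>v\<^sub>j\<close> with eigenvalues \<open>l\<^sub>j\<close> in non-increasing order.
  By Ky Fan's principle the sum \<open>S\<^sub>k(Y)\<close> of the k largest eigenvalues is the maximum of
  \<open>\<Sum>j<k. \<langle>w\<^sub>j, Y w\<^sub>j\<rangle>\<close> over orthonormal frames. So the slopes \<open>(S\<^sub>k(C + tX) - S\<^sub>k(C)) / t\<close> are monotone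
  in t and bounded below by \<open>\<Sum>j<k. \<langle>v\<^sub>j, X v\<^sub>j\<rangle>\<close>, while for \<open>X = f(C)\<close> they are constantly
  \<open>\<Sum>j<k. f(l\<^sub>j)\<close>, because f is non-decreasing. It remains to see that
  \<open>\<Sum>j<k. f(l\<^sub>j) \<le> \<Sum>j<k. \<langle>v\<^sub>j, (f(A) + f(B)) v\<^sub>j\<rangle>\<close>. For \<open>k = n\<close> this is Rotfel'd's trace inequality,
  which follows from Jensen's inequality since \<open>A, B \<le> C\<close>. For \<open>k < n\<close> one applies the trace inequality
  to the concave function \<open>g(x) = min (f x) (\<mu> x)\<close>, where \<open>\<mu>\<close> is the chord slope of f at \<open>l\<^sub>k\<close>: it agrees
  with f at \<open>l\<^sub>j\<close> for \<open>j < k\<close> and with \<open>\<mu> x\<close> at the remaining eigenvalues, so that the terms with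
  \<open>j \<ge> k\<close> can be removed from both sides.
\<close>

subsection \<open>Quadratic forms and unitary bases\<close>

lemma mat_adjoint_carrier [simp]: "M \<in> carrier_mat m n \<Longrightarrow> mat_adjoint M \<in> carrier_mat n m"
  by (auto simp: mat_adjoint_def)

lemma mat_adjoint_dim [simp]:
  "dim_row (mat_adjoint M) = dim_col M" "dim_col (mat_adjoint M) = dim_row M"
  by (auto simp: mat_adjoint_def)

lemma mat_adjoint_index [simp]:
  fixes M :: "complex mat"
  assumes "i < dim_col M" "j < dim_row M"
  shows "mat_adjoint M $$ (i, j) = cnj (M $$ (j, i))"
  using assms by (simp add: mat_adjoint_def mat_of_rows_def)

lemma mat_adjoint_adjoint [simp]: "mat_adjoint (mat_adjoint M) = (M :: complex mat)"
  by (rule eq_matI) auto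

lemma mat_adjoint_mult:
  fixes M N :: "complex mat"
  assumes "M \<in> carrier_mat l m" "N \<in> carrier_mat m n"
  shows "mat_adjoint (M * N) = mat_adjoint N * mat_adjoint M"
  by (rule eq_matI) (use assms in \<open>auto simp: scalar_prod_def mult.commute\<close>)

lemma hermitian_mat_iff:
  assumes "M \<in> carrier_mat n n"
  shows "hermitian_mat M \<longleftrightarrow> (\<forall>i<n. \<forall>j<n. M $$ (i, j) = cnj (M $$ (j, i)))"
proof
  assume "hermitian_mat M"
  then have eq: "mat_adjoint M = M" by (simp add: hermitian_mat_def)
  show "\<forall>i<n. \<forall>j<n. M $$ (i, j) = cnj (M $$ (j, i))"
  proof (intro allI impI)
    fix i j assume "i < n" "j < n"
    then show "M $$ (i, j) = cnj (M $$ (j, i))"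
      using assms mat_adjoint_index[of i M j] unfolding eq carrier_matD[OF assms] by simp
  qed
next
  assume *: "\<forall>i<n. \<forall>j<n. M $$ (i, j) = cnj (M $$ (j, i))"
  have "mat_adjoint M = M"
  proof (rule eq_matI)
    fix i j assume "i < dim_row M" "j < dim_col M"
    then show "mat_adjoint M $$ (i, j) = M $$ (i, j)"
      using assms *[rule_format, of i j] carrier_matD[OF assms] by simp
  qed (use assms in auto)
  then show "hermitian_mat M" using assms by (auto simp: hermitian_mat_def)
qed

lemma hermitian_mat_add:
  assumes "M \<in> carrier_mat n n" "N \<in> carrier_mat n n" "hermitian_mat M" "hermitian_mat N"
  shows "hermitian_mat (M + N)"
proof -
  have "M $$ (i, j) + N $$ (i, j) = cnj (M $$ (j, i) + N $$ (j, i))" if "i < n" "j < n" for i j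
    using assms that hermitian_mat_iff[of M n] hermitian_mat_iff[of N n]
    by (metis complex_cnj_add)
  then show ?thesis using assms hermitian_mat_iff[of "M + N" n] by simp
qed

lemma hermitian_mat_smult:
  assumes "M \<in> carrier_mat n n" "hermitian_mat M"
  shows "hermitian_mat (complex_of_real t \<cdot>\<^sub>m M)"
proof -
  have "t * M $$ (i, j) = cnj (t * M $$ (j, i))" if "i < n" "j < n" for i j
    using assms that hermitian_mat_iff[of M n]
    by (metis complex_cnj_mult complex_cnj_complex_of_real)
  then show ?thesis using assms hermitian_mat_iff[of "complex_of_real t \<cdot>\<^sub>m M" n] by simp
qed

lemma scalar_prod_adjoint:
  fixes M :: "complex mat"
  assumes "M \<in> carrier_mat m n" "x \<in> carrier_vec n" "y \<in> carrier_vec m"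
  shows "(M *\<^sub>v x) \<bullet>c y = x \<bullet>c (mat_adjoint M *\<^sub>v y)"
proof -
  have "(M *\<^sub>v x) \<bullet>c y = (\<Sum>i<m. \<Sum>j<n. M $$ (i,j) * x $ j * cnj (y $ i))"
    using assms by (simp add: scalar_prod_def sum_distrib_right atLeast0LessThan)
  also have "\<dots> = (\<Sum>j<n. \<Sum>i<m. M $$ (i,j) * x $ j * cnj (y $ i))"
    by (rule sum.swap)
  also have "\<dots> = x \<bullet>c (mat_adjoint M *\<^sub>v y)"
    using assms by (simp add: scalar_prod_def sum_distrib_left atLeast0LessThan ac_simps)
  finally show ?thesis .
qed

section \<open>Real quadratic forms\<close>

text \<open>For Hermitian \<open>M\<close> the form is already real, so \<open>Re\<close> only
  changes the type and lets forms be compared as real numbers.\<close>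

definition qform :: "complex mat \<Rightarrow> complex vec \<Rightarrow> real" where
  "qform M v = Re ((M *\<^sub>v v) \<bullet>c v)"

lemma qform_add:
  assumes "M \<in> carrier_mat n n" "N \<in> carrier_mat n n" "v \<in> carrier_vec n"
  shows "qform (M + N) v = qform M v + qform N v"
  using assms unfolding qform_def
  by (simp add: add_mult_distrib_mat_vec[of M n n N v] add_scalar_prod_distrib[of _ n])

lemma qform_smult:
  assumes "M \<in> carrier_mat n n" "v \<in> carrier_vec n"
  shows "qform (complex_of_real t \<cdot>\<^sub>m M) v = t * qform M v"
proof -
  have "(complex_of_real t \<cdot>\<^sub>m M) *\<^sub>v v = complex_of_real t \<cdot>\<^sub>v (M *\<^sub>v v)"
    by (rule eq_vecI) (use assms in auto)
  then show ?thesis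
    using assms smult_scalar_prod_distrib[of "M *\<^sub>v v" n "conjugate v" "complex_of_real t"]
    by (simp add: qform_def del: smult_scalar_prod_distrib)
qed

section \<open>Unitary matrices and expansions in eigenbases\<close>

lemma unitary_matD:
  assumes "unitary_mat n U"
  shows "U \<in> carrier_mat n n" "mat_adjoint U \<in> carrier_mat n n"
    "mat_adjoint U * U = 1\<^sub>m n" "U * mat_adjoint U = 1\<^sub>m n"
  using assms by (auto simp: unitary_mat_def)

text \<open>A left inverse of a square matrix is also a right inverse.\<close>

lemma unitary_matI:
  assumes "U \<in> carrier_mat n n" "mat_adjoint U * U = 1\<^sub>m n"
  shows "unitary_mat n U"
  using assms mat_mult_left_right_inverse[of "mat_adjoint U" n U] by (auto simp: unitary_mat_def)

lemma unitary_mat_mult: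
  assumes U: "unitary_mat n U" and V: "unitary_mat n V"
  shows "unitary_mat n (U * V)"
proof (rule unitary_matI)
  note u = unitary_matD[OF U] and v = unitary_matD[OF V]
  show "U * V \<in> carrier_mat n n" using u v by simp
  have "mat_adjoint (U * V) * (U * V) = mat_adjoint V * (mat_adjoint U * (U * V))"
    using u(1,2) v(1,2) by (simp add: mat_adjoint_mult[of U n n] assoc_mult_mat[of _ n n _ n _ n])
  also have "mat_adjoint U * (U * V) = (mat_adjoint U * U) * V"
    using u(1,2) v(1) by (simp only: assoc_mult_mat[of _ n n _ n _ n])
  also have "mat_adjoint V * ((mat_adjoint U * U) * V) = 1\<^sub>m n" using u v by simp
  finally show "mat_adjoint (U * V) * (U * V) = 1\<^sub>m n" .
qed

text \<open>Moving \<open>U\<close> to the other side of the inner product leaves the form of the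
  diagonal matrix at the coordinates of \<open>v\<close> in the eigenbasis.\<close>

lemma qform_diagonalized:
  assumes M: "M \<in> carrier_mat n n" "diagonalized_by M U d" and v: "v \<in> carrier_vec n"
  shows "qform M v = (\<Sum>i<n. d i * (cmod ((mat_adjoint U *\<^sub>v v) $ i))\<^sup>2)"
proof -
  let ?D = "mat_diag n (\<lambda>i. complex_of_real (d i))"
  have U: "U \<in> carrier_mat n n" "mat_adjoint U \<in> carrier_mat n n"
    and MU: "M = U * ?D * mat_adjoint U"
    using M unitary_matD[of n U] by (auto simp: diagonalized_by_def)
  define y where "y = mat_adjoint U *\<^sub>v v"
  have y: "y \<in> carrier_vec n" using U(2) v unfolding y_def by (rule mult_mat_vec_carrier)
  have D: "?D \<in> carrier_mat n n" by simp
  have "M *\<^sub>v v = (U * ?D) *\<^sub>v y"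
    unfolding MU y_def using U v D by (intro assoc_mult_mat_vec[of _ n n _ n]) auto
  also have "\<dots> = U *\<^sub>v (?D *\<^sub>v y)"
    using U y D by (intro assoc_mult_mat_vec[of _ n n _ n]) auto
  finally have "M *\<^sub>v v = U *\<^sub>v (?D *\<^sub>v y)" .
  then have "(M *\<^sub>v v) \<bullet>c v = (?D *\<^sub>v y) \<bullet>c y"
    using scalar_prod_adjoint[of U n n "?D *\<^sub>v y" v] U v D y by (simp add: y_def)
  also have "\<dots> = (\<Sum>i<n. complex_of_real (d i) * y $ i * cnj (y $ i))"
    using y
    by (auto simp: scalar_prod_def mat_diag_def atLeast0LessThan if_distribR if_distrib[of "\<lambda>z. z * _"]
        cong: if_cong intro!: sum.cong)
  also have "\<dots> = complex_of_real (\<Sum>i<n. d i * (cmod (y $ i))\<^sup>2)"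
    by (simp add: mult.assoc complex_norm_square[symmetric])
  finally show ?thesis by (simp add: qform_def y_def)
qed

text \<open>For unitary U and V, \<open>overlap U V i j\<close> is \<open>|\<langle>u\<^sub>i, v\<^sub>j\<rangle>|\<^sup>2\<close> for the columns \<open>u\<^sub>i\<close> and \<open>v\<^sub>j\<close>.\<close>

definition overlap :: "complex mat \<Rightarrow> complex mat \<Rightarrow> nat \<Rightarrow> nat \<Rightarrow> real" where
  "overlap U V i j = (cmod ((mat_adjoint U * V) $$ (i, j)))\<^sup>2"

lemma overlap_nonneg [simp]: "0 \<le> overlap U V i j"
  by (simp add: overlap_def)

lemma overlap_commute:
  assumes "U \<in> carrier_mat n n" "V \<in> carrier_mat n n" "i < n" "j < n"
  shows "overlap U V i j = overlap V U j i"
proof -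
  have "mat_adjoint U * V = mat_adjoint (mat_adjoint V * U)"
    using assms by (simp add: mat_adjoint_mult[of _ n n])
  then have "(mat_adjoint U * V) $$ (i, j) = cnj ((mat_adjoint V * U) $$ (j, i))"
    using assms by (simp del: index_mult_mat(1))
  then show ?thesis by (simp add: overlap_def del: index_mult_mat(1))
qed

lemma overlap_eq:
  assumes "U \<in> carrier_mat n n" "V \<in> carrier_mat n n" "i < n" "j < n"
  shows "overlap U V i j = (cmod ((mat_adjoint U *\<^sub>v col V j) $ i))\<^sup>2"
  using assms by (simp add: overlap_def)

lemma qform_col:
  assumes "M \<in> carrier_mat n n" "diagonalized_by M U d" "V \<in> carrier_mat n n" "j < n"
  shows "qform M (col V j) = (\<Sum>i<n. d i * overlap U V i j)"
proof -
  have "U \<in> carrier_mat n n" using assms by (auto simp: diagonalized_by_def unitary_mat_def)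
  then show ?thesis
    using assms qform_diagonalized[OF assms(1,2), of "col V j"]
    by (simp add: overlap_eq[of U n V] del: index_mult_mat_vec)
qed

text \<open>Every unitary \<open>U\<close> diagonalizes the identity, so the sum is the form of the
  identity at a unit vector. With the companion for rows this makes the overlaps a doubly stochastic
  matrix.\<close>

lemma sum_overlap_left:
  assumes U: "unitary_mat n U" and V: "unitary_mat n V" and "j < n"
  shows "(\<Sum>i<n. overlap U V i j) = 1"
proof -
  note u = unitary_matD[OF U] and v = unitary_matD[OF V]
  have "diagonalized_by (1\<^sub>m n) U (\<lambda>_. 1)"
    using u U by (simp add: diagonalized_by_def)
  then have "(\<Sum>i<n. overlap U V i j) = qform (1\<^sub>m n) (col V j)"
    using qform_col[of "1\<^sub>m n" n U _ V j] v assms(3) by simp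
  also have "\<dots> = Re ((mat_adjoint V * V) $$ (j, j))"
    using v(1,2) assms(3) by (simp add: qform_def scalar_prod_def mult.commute)
  finally show ?thesis using v(3) assms(3) by simp
qed

lemma sum_overlap_right:
  assumes U: "unitary_mat n U" and V: "unitary_mat n V" and "i < n"
  shows "(\<Sum>j<n. overlap U V i j) = 1"
  using sum_overlap_left[OF V U assms(3)] overlap_commute[of U n V i] assms
  by (simp add: unitary_matD)

lemma overlap_self:
  assumes "unitary_mat n U" "i < n" "j < n"
  shows "overlap U U i j = (if i = j then 1 else 0)"
  using assms by (auto simp: overlap_def unitary_matD(3) simp del: index_mult_mat(1))

lemma qform_col_eigenvector:
  assumes "M \<in> carrier_mat n n" "diagonalized_by M U d" "j < n"
  shows "qform M (col U j) = d j"
proof -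
  have U: "unitary_mat n U" using assms by (auto simp: diagonalized_by_def)
  have "qform M (col U j) = (\<Sum>i<n. d i * overlap U U i j)"
    using assms U by (intro qform_col) (auto dest: unitary_matD)
  also have "\<dots> = d j" using assms(3) U by (simp add: overlap_self if_distrib cong: if_cong)
  finally show ?thesis .
qed

text \<open>The sum is the form of the pseudo-inverse of \<open>C\<close> at the eigenvector
  \<open>col U i\<close>. Testing the domination of \<open>A\<close> by \<open>C\<close> at
  \<open>x\<close>, the pseudo-inverse applied to this eigenvector, gives \<open>s\<close> on the
  side of \<open>C\<close> and at least \<open>a i * s\<^sup>2\<close> on the side of
  \<open>A\<close>.\<close>

lemma sum_overlap_divide_le:
  assumes "A \<in> carrier_mat n n" "diagonalized_by A U a"
    and "C \<in> carrier_mat n n" "diagonalized_by C V l"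
    and a: "\<And>i. i < n \<Longrightarrow> 0 \<le> a i" and l: "\<And>j. j < n \<Longrightarrow> 0 \<le> l j"
    and le: "\<And>x. x \<in> carrier_vec n \<Longrightarrow> qform A x \<le> qform C x"
    and i: "i < n"
  shows "a i * (\<Sum>j<n. overlap U V i j / l j) \<le> 1"
proof -
  have UV: "unitary_mat n U" "unitary_mat n V"
    using assms by (auto simp: diagonalized_by_def)
  note u = unitary_matD[OF UV(1)] and v = unitary_matD[OF UV(2)]
  define c where "c = mat_adjoint V *\<^sub>v col U i"
  \<comment> \<open>Since division by 0 gives 0, the directions in the kernel of \<open>C\<close>
    drop out; these are the coordinates of the pseudo-inverse applied to
    \<open>col U i\<close>.\<close>
  define y where "y = vec n (\<lambda>j. c $ j / complex_of_real (l j))"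
  define x where "x = V *\<^sub>v y"
  define s where "s = (\<Sum>j<n. overlap U V i j / l j)"
  have car: "c \<in> carrier_vec n" "y \<in> carrier_vec n" "x \<in> carrier_vec n"
    using mult_mat_vec_carrier[OF v(2), of "col U i"] mult_mat_vec_carrier[OF v(1), of y] u i
    by (auto simp: c_def y_def x_def)
  have ov: "overlap U V i j = (cmod (c $ j))\<^sup>2" if "j < n" for j
    using overlap_commute[OF u(1) v(1) i that] overlap_eq[OF v(1) u(1) that i] by (simp add: c_def)
  have s0: "0 \<le> s" unfolding s_def by (intro sum_nonneg divide_nonneg_nonneg) (auto simp: l)
  have "mat_adjoint V *\<^sub>v x = y"
    using v car by (simp add: x_def assoc_mult_mat_vec[symmetric, of _ n n _ n])
  then have "qform C x = (\<Sum>j<n. l j * (cmod (y $ j))\<^sup>2)"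
    using qform_diagonalized[OF assms(3,4) car(3)] by simp
  also have "\<dots> = s"
    unfolding s_def by (intro sum.cong) (auto simp: y_def ov norm_divide power_divide power2_eq_square l)
  finally have Cx: "qform C x = s" .
  have "(mat_adjoint U *\<^sub>v x) $ i = x \<bullet>c col U i"
    using u car i by (simp add: scalar_prod_def mult.commute)
  also have "\<dots> = y \<bullet>c c"
    using scalar_prod_adjoint[OF v(1) car(2), of "col U i"] u i by (simp add: x_def c_def)
  also have "\<dots> = (\<Sum>j<n. complex_of_real (overlap U V i j / l j))"
    using car by (auto simp: scalar_prod_def y_def atLeast0LessThan ov complex_norm_square[symmetric] of_real_power[symmetric] simp del: of_real_power intro!: sum.cong)
  also have "\<dots> = complex_of_real s" by (simp add: s_def)
  finally have "a i * s\<^sup>2 = a i * (cmod ((mat_adjoint U *\<^sub>v x) $ i))\<^sup>2" by simp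
  \<comment> \<open>Only the i-th term of the expansion of \<open>qform A x\<close> is kept.\<close>
  also have "\<dots> \<le> (\<Sum>i<n. a i * (cmod ((mat_adjoint U *\<^sub>v x) $ i))\<^sup>2)"
    using i by (intro member_le_sum[of i "{..<n}" "\<lambda>i. a i * (cmod ((mat_adjoint U *\<^sub>v x) $ i))\<^sup>2"]) (auto simp: a)
  also have "\<dots> = qform A x" using qform_diagonalized[OF assms(1,2) car(3)] by simp
  also have "\<dots> \<le> s" using le[OF car(3)] Cx by simp
  finally have "(a i * s) * s \<le> 1 * s" by (simp add: power2_eq_square mult.assoc)
  then have "a i * s \<le> 1" using s0 by (cases "s = 0") (auto simp: mult_le_cancel_right)
  then show ?thesis by (simp add: s_def)
qed

subsection \<open>Partial trace inequalities for concave functions\<close>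

text \<open>Jensen's inequality for weights of total mass at most 1: the missing mass is placed at
  0, where \<open>g\<close> vanishes.\<close>

lemma concave_sum_le:
  fixes g :: "real \<Rightarrow> real" and n :: nat
  assumes g: "concave_on {0..} g" "g 0 = 0"
    and p: "\<And>j. j < n \<Longrightarrow> 0 \<le> p j" "(\<Sum>j<n. p j) \<le> 1"
    and x: "\<And>j. j < n \<Longrightarrow> 0 \<le> x j"
  shows "(\<Sum>j<n. p j * g (x j)) \<le> g (\<Sum>j<n. p j * x j)"
proof -
  \<comment> \<open>The additional index \<open>n\<close> carries the missing mass, at the point
    0.\<close>
  define q where "q j = (if j < n then p j else 1 - (\<Sum>j<n. p j))" for j
  define y where "y j = (if j < n then x j else 0)" for j
  have last: "sum h {..n} = sum h {..<n} + h n" for h :: "nat \<Rightarrow> real"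
    by (simp add: lessThan_Suc_atMost[symmetric] del: lessThan_Suc_atMost)
  have "convex_on {0..} (\<lambda>x. - g x)" using g by (simp add: concave_on_def)
  then have "- g (\<Sum>j\<in>{..n}. q j *\<^sub>R y j) \<le> (\<Sum>j\<in>{..n}. q j * - g (y j))"
    by (intro convex_on_sum) (use p x in \<open>auto simp: q_def y_def last\<close>)
  then show ?thesis
    by (simp add: q_def y_def g(2) last sum_negf)
qed

text \<open>The point \<open>x\<close> lies between 0 and \<open>y\<close> with weight
  \<open>x / y\<close> on \<open>y\<close>, so a single term of Jensen's inequality
  suffices.\<close>

lemma concave_ratio_antimono:
  fixes f :: "real \<Rightarrow> real"
  assumes f: "concave_on {0..} f" "f 0 = 0" and "0 < x" "x \<le> y"
  shows "f y / y \<le> f x / x"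
proof -
  have "(\<Sum>j<Suc 0. x / y * f y) \<le> f (\<Sum>j<Suc 0. x / y * y)"
    by (rule concave_sum_le[OF f]) (use assms in auto)
  then have "x / y * f y \<le> f x" using assms by simp
  then show ?thesis using assms by (simp add: field_simps)
qed

text \<open>A decrease would force a concave function below 0 further to the right. Quantitatively,
  \<open>f y\<close> is at least \<open>t * f x\<close> for every \<open>t\<close> strictly between
  0 and 1.\<close>

lemma concave_nonneg_mono:
  fixes f :: "real \<Rightarrow> real"
  assumes f: "concave_on {0..} f" and nonneg: "\<And>x. 0 \<le> x \<Longrightarrow> 0 \<le> f x" and "0 \<le> x" "x \<le> y"
  shows "f x \<le> f y"
proof (rule field_le_mult_one_interval)
  fix t :: real
  assume t: "0 < t" "t < 1"
  \<comment> \<open>The point beyond \<open>y\<close> for which \<open>y\<close> is the convex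
    combination of \<open>x\<close> and \<open>z\<close> with weights \<open>t\<close> and
    \<open>1 - t\<close>.\<close>
  define z where "z = x + (y - x) / (1 - t)"
  have z: "0 \<le> z" using assms t by (simp add: z_def)
  have "t * f x + (1 - t) * f z \<le> f (t * x + (1 - t) * z)"
    using f[unfolded concave_on_iff] t \<open>0 \<le> x\<close> z by auto
  also have "t * x + (1 - t) * z = y" using t by (simp add: z_def distrib_left) (simp add: algebra_simps)
  finally have "t * f x + (1 - t) * f z \<le> f y" .
  moreover have "0 \<le> (1 - t) * f z" using nonneg[OF z] t by (intro mult_nonneg_nonneg) auto
  ultimately show "t * f x \<le> f y" by linarith
qed

text \<open>On the kernel of \<open>C\<close> the form of \<open>A\<close> is at most 0, while its
  expansion in the eigenbasis of \<open>A\<close> has non-negative terms, so each term vanishes.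
  This settles the indices at which a quotient by \<open>l j\<close> degenerates to 0.\<close>

lemma qform_dominated_eq_0:
  assumes "A \<in> carrier_mat n n" "diagonalized_by A U a"
    and "C \<in> carrier_mat n n" "diagonalized_by C V l"
    and a: "\<And>i. i < n \<Longrightarrow> 0 \<le> a i"
    and le: "\<And>x. x \<in> carrier_vec n \<Longrightarrow> qform A x \<le> qform C x"
    and ij: "i < n" "j < n" and "l j = 0"
  shows "a i * overlap U V i j = 0" "qform A (col V j) = 0"
proof -
  have V: "V \<in> carrier_mat n n"
    using assms(3,4) by (auto simp: diagonalized_by_def unitary_mat_def)
  have eq: "qform A (col V j) = (\<Sum>i<n. a i * overlap U V i j)"
    using qform_col[OF assms(1,2) V ij(2)] .
  moreover have "qform A (col V j) \<le> 0"
    using le[OF col_carrier_vec[OF ij(2) V]] qform_col_eigenvector[OF assms(3,4) ij(2)] \<open>l j = 0\<close>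
    by simp
  moreover have nonneg: "0 \<le> a i * overlap U V i j" if "i < n" for i
    using a[OF that] by simp
  ultimately have z: "(\<Sum>i<n. a i * overlap U V i j) = 0"
    by (intro order_antisym sum_nonneg) auto
  then show "qform A (col V j) = 0" using eq by simp
  show "a i * overlap U V i j = 0"
    using z nonneg ij sum_nonneg_eq_0_iff[of "{..<n}" "\<lambda>i. a i * overlap U V i j"]
    by (auto simp del: mult_eq_0_iff)
qed

text \<open>Jensen's inequality with the sub-probability weights \<open>a\<^sub>i |\<langle>u\<^sub>i, v\<^sub>j\<rangle>|\<^sup>2 / l\<^sub>j\<close>. Summed over a
  decomposition \<open>C = A + B\<close>, it gives \<open>tr g(C) \<le> tr g(A) + tr g(B)\<close>.\<close>

lemma concave_sum_dominated:
  assumes "A \<in> carrier_mat n n" "diagonalized_by A U a"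
    and "C \<in> carrier_mat n n" "diagonalized_by C V l"
    and a: "\<And>i. i < n \<Longrightarrow> 0 \<le> a i" and l: "\<And>j. j < n \<Longrightarrow> 0 \<le> l j"
    and le: "\<And>x. x \<in> carrier_vec n \<Longrightarrow> qform A x \<le> qform C x"
    and g: "concave_on {0..} g" "g 0 = 0"
  shows "(\<Sum>j<n. g (l j) / l j * qform A (col V j)) \<le> (\<Sum>i<n. g (a i))"
proof -
  have UV: "unitary_mat n U" "unitary_mat n V"
    using assms by (auto simp: diagonalized_by_def)
  define p where "p i j = a i * overlap U V i j / l j" for i j
  \<comment> \<open>If \<open>l j = 0\<close>, the right-hand side vanishes because \<open>C\<close>
    dominates \<open>A\<close>.\<close>
  have pl: "p i j * l j = a i * overlap U V i j" if "i < n" "j < n" for i j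
    using qform_dominated_eq_0(1)[OF assms(1-5) le that] by (auto simp: p_def)
  have "(\<Sum>j<n. p i j * g (l j)) \<le> g (a i)" if i: "i < n" for i
  proof -
    have "(\<Sum>j<n. p i j) \<le> 1"
      using sum_overlap_divide_le[OF assms(1-4) a l le i] by (simp add: p_def sum_distrib_left)
    then have "(\<Sum>j<n. p i j * g (l j)) \<le> g (\<Sum>j<n. p i j * l j)"
      using a[OF i] l by (intro concave_sum_le[OF g]) (auto simp: p_def)
    \<comment> \<open>The barycentre of the points \<open>l j\<close> is \<open>a i\<close> itself,
      as the overlaps in row \<open>i\<close> add up to 1.\<close>
    also have "(\<Sum>j<n. p i j * l j) = a i * (\<Sum>j<n. overlap U V i j)"
      unfolding sum_distrib_left using i by (intro sum.cong) (auto simp: pl)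
    also have "\<dots> = a i" using sum_overlap_right[OF UV i] by simp
    finally show ?thesis .
  qed
  then have "(\<Sum>i<n. \<Sum>j<n. p i j * g (l j)) \<le> (\<Sum>i<n. g (a i))"
    by (intro sum_mono) auto
  also have "(\<Sum>i<n. \<Sum>j<n. p i j * g (l j)) = (\<Sum>j<n. \<Sum>i<n. p i j * g (l j))"
    by (rule sum.swap)
  also have "\<dots> = (\<Sum>j<n. g (l j) / l j * qform A (col V j))"
  proof (rule sum.cong)
    fix j assume "j \<in> {..<n}"
    then have "qform A (col V j) = (\<Sum>i<n. a i * overlap U V i j)"
      using qform_col[OF assms(1,2), of V j] unitary_matD[OF UV(2)] by simp
    then show "(\<Sum>i<n. p i j * g (l j)) = g (l j) / l j * qform A (col V j)"
      by (simp add: p_def sum_distrib_left mult.commute)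
  qed simp
  finally show ?thesis .
qed

text \<open>Replacing f by \<open>min f (\<mu>\<cdot>)\<close> with the chord slope \<open>\<mu> = f(l\<^sub>k) / l\<^sub>k\<close> makes the contribution
  of the complement of the leading eigenspaces linear, so that the full trace inequality
  restricts to the leading eigenvectors.\<close>

lemma concave_partial_sum_dominated:
  assumes "A \<in> carrier_mat n n" "diagonalized_by A U a"
    and "C \<in> carrier_mat n n" "diagonalized_by C V l"
    and a: "\<And>i. i < n \<Longrightarrow> 0 \<le> a i" and l: "\<And>j. j < n \<Longrightarrow> 0 \<le> l j"
    and dec: "\<And>i j. i \<le> j \<Longrightarrow> j < n \<Longrightarrow> l j \<le> l i"
    and le: "\<And>x. x \<in> carrier_vec n \<Longrightarrow> qform A x \<le> qform C x"
    and f: "concave_on {0..} f" "f 0 = 0" "\<And>x. 0 \<le> x \<Longrightarrow> 0 \<le> f x"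
    and k: "k \<le> n"
  shows "(\<Sum>j<k. f (l j) / l j * qform A (col V j))
    \<le> (\<Sum>j<k. \<Sum>i<n. f (a i) * overlap U V i j)"
proof -
  have UV: "unitary_mat n U" "unitary_mat n V"
    using assms by (auto simp: diagonalized_by_def)
  \<comment> \<open>The line of slope \<open>\<mu>\<close> through the origin separates the leading
    eigenvalues from the others, because the ratio \<open>f x / x\<close> does not increase with
    \<open>x\<close>.\<close>
  obtain \<mu> where below: "\<And>j. j < k \<Longrightarrow> f (l j) \<le> \<mu> * l j"
    and above: "\<And>j. k \<le> j \<Longrightarrow> j < n \<Longrightarrow> \<mu> * l j \<le> f (l j)"
  proof (cases "k < n \<and> 0 < l k")
    case True
    show ?thesis
    proof (rule that[of "f (l k) / l k"])
      fix j assume j: "j < k"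
      have "f (l j) / l j \<le> f (l k) / l k"
        using dec[of j k] j True by (intro concave_ratio_antimono[OF f(1,2)]) auto
      then show "f (l j) \<le> f (l k) / l k * l j"
        using dec[of j k] j True by (simp add: pos_divide_le_eq)
    next
      fix j assume j: "k \<le> j" "j < n"
      show "f (l k) / l k * l j \<le> f (l j)"
      proof (cases "l j = 0")
        case False
        then have "0 < l j" using l[OF j(2)] by simp
        then have "f (l k) / l k \<le> f (l j) / l j"
          using dec[OF j] by (intro concave_ratio_antimono[OF f(1,2)]) auto
        then show ?thesis using \<open>0 < l j\<close> by (simp add: pos_le_divide_eq)
      qed (simp add: f(2))
    qed
  next
    case False
    show ?thesis
    \<comment> \<open>Here no eigenvalue with index from \<open>k\<close> on is positive, so any
      slope bounding all the ratios works; their sum does, as they are non-negative.\<close>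
    proof (rule that[of "\<Sum>j<n. f (l j) / l j"])
      fix j assume j: "j < k"
      show "f (l j) \<le> (\<Sum>j<n. f (l j) / l j) * l j"
      proof (cases "l j = 0")
        case False
        then have pos: "0 < l j" using l[of j] j k by simp
        have "f (l j) / l j \<le> (\<Sum>j<n. f (l j) / l j)"
          by (rule member_le_sum) (use j k f(3) l in auto)
        then show ?thesis using pos by (simp add: pos_divide_le_eq)
      qed (simp add: f(2))
    next
      fix j assume j: "k \<le> j" "j < n"
      then have "l j \<le> 0" using dec[OF j] False by auto
      then have "l j = 0" using l[OF j(2)] by simp
      then show "(\<Sum>j<n. f (l j) / l j) * l j \<le> f (l j)" by (simp add: f(2))
    qed
  qed
  define g where "g x = min (f x) (\<mu> * x)" for x
  have g: "concave_on {0..} g" "g 0 = 0"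
  proof -
    have "s * g x + t * g y \<le> g (s * x + t * y)"
      if xy: "0 \<le> x" "0 \<le> y" and st: "0 \<le> s" "0 \<le> t" "s + t = 1" for x y s t
    proof -
      have "s * g x + t * g y \<le> s * f x + t * f y"
        using st by (intro add_mono mult_left_mono) (auto simp: g_def)
      also have "\<dots> \<le> f (s * x + t * y)" using f(1) xy st by (auto simp: concave_on_iff)
      finally have 1: "s * g x + t * g y \<le> f (s * x + t * y)" .
      have "s * g x + t * g y \<le> s * (\<mu> * x) + t * (\<mu> * y)"
        using st by (intro add_mono mult_left_mono) (auto simp: g_def)
      then have "s * g x + t * g y \<le> \<mu> * (s * x + t * y)" by (simp add: algebra_simps)
      with 1 show ?thesis by (simp add: g_def)
    qed
    then show "concave_on {0..} g" by (auto simp: concave_on_iff)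
  qed (simp add: g_def f(2))
  define r where "r j = qform A (col V j)" for j
  define w where "w = overlap U V"
  have r: "r j = (\<Sum>i<n. a i * w i j)" if "j < n" for j
    using that qform_col[OF assms(1,2), of V j] unitary_matD[OF UV(2)] by (simp add: r_def w_def)
  have w0: "0 \<le> w i j" for i j by (simp add: w_def)
  have sw: "(\<Sum>j<n. w i j) = 1" if "i < n" for i
    using sum_overlap_right[OF UV that] by (simp add: w_def)
  have split: "sum h {..<n} = sum h {..<k} + sum h {k..<n}" for h :: "nat \<Rightarrow> real"
    using k by (metis atLeast0LessThan sum.atLeastLessThan_concat zero_le)
  \<comment> \<open>On the complement \<open>g\<close> agrees with the line; where
    \<open>l j = 0\<close>, both sides vanish because \<open>r j\<close> does.\<close>
  have tail: "g (l j) / l j * r j = \<mu> * r j" if "k \<le> j" "j < n" for j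
  proof (cases "l j = 0")
    case True
    then show ?thesis
      using qform_dominated_eq_0(2)[OF assms(1-5) le that(2,2)] by (simp add: r_def)
  qed (use above[OF that] in \<open>simp add: g_def\<close>)
  have "(\<Sum>j<k. f (l j) / l j * r j) = (\<Sum>j<n. g (l j) / l j * r j) - (\<Sum>j=k..<n. \<mu> * r j)"
    unfolding split using below tail by (simp add: g_def)
  also have "(\<Sum>j<n. g (l j) / l j * r j) \<le> (\<Sum>i<n. g (a i))"
    using concave_sum_dominated[OF assms(1-4) a l le g] by (simp add: r_def)
  also have "(\<Sum>i<n. g (a i)) = (\<Sum>i<n. \<Sum>j<n. g (a i) * w i j)"
    by (simp add: sum_distrib_left[symmetric] sw)
  also have "\<dots> = (\<Sum>j<n. \<Sum>i<n. g (a i) * w i j)"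
    by (rule sum.swap)
  also have "\<dots> = (\<Sum>j<k. \<Sum>i<n. g (a i) * w i j) + (\<Sum>j=k..<n. \<Sum>i<n. g (a i) * w i j)"
    by (rule split)
  \<comment> \<open>Bounding \<open>g\<close> by the line on the complement reproduces exactly the
    subtracted tail. On the leading part \<open>g\<close> is then bounded by
    \<open>f\<close>.\<close>
  also have "(\<Sum>j=k..<n. \<Sum>i<n. g (a i) * w i j) \<le> (\<Sum>j=k..<n. \<mu> * r j)"
  proof (rule sum_mono)
    fix j assume "j \<in> {k..<n}"
    then show "(\<Sum>i<n. g (a i) * w i j) \<le> \<mu> * r j"
      by (auto simp: r sum_distrib_left g_def mult.assoc[symmetric] w0 intro!: sum_mono mult_right_mono)
  qed
  also have "(\<Sum>j<k. \<Sum>i<n. g (a i) * w i j) \<le> (\<Sum>j<k. \<Sum>i<n. f (a i) * w i j)"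
    by (intro sum_mono mult_right_mono w0) (simp add: g_def)
  finally show ?thesis by (simp add: r_def w_def)
qed

subsection \<open>The spectral theorem\<close>

lemma unitary_mat_iff:
  assumes "U \<in> carrier_mat n n"
  shows "unitary_mat n U \<longleftrightarrow>
    (\<forall>i<n. \<forall>j<n. (\<Sum>k<n. cnj (U $$ (k, i)) * U $$ (k, j)) = (if i = j then 1 else 0))"
proof -
  have ent: "(mat_adjoint U * U) $$ (i, j) = (\<Sum>k<n. cnj (U $$ (k, i)) * U $$ (k, j))"
    if "i < n" "j < n" for i j
    using assms that by (simp add: scalar_prod_def atLeast0LessThan)
  show ?thesis
  proof
    assume "unitary_mat n U"
    then have "mat_adjoint U * U = 1\<^sub>m n" by (rule unitary_matD)
    then show "\<forall>i<n. \<forall>j<n. (\<Sum>k<n. cnj (U $$ (k, i)) * U $$ (k, j)) = (if i = j then 1 else 0)"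
      using ent by simp
  next
    assume *: "\<forall>i<n. \<forall>j<n. (\<Sum>k<n. cnj (U $$ (k, i)) * U $$ (k, j)) = (if i = j then 1 else 0)"
    have "mat_adjoint U * U = 1\<^sub>m n"
    proof (rule eq_matI)
      fix i j assume "i < dim_row (1\<^sub>m n :: complex mat)" "j < dim_col (1\<^sub>m n :: complex mat)"
      then have ij: "i < n" "j < n" by auto
      show "(mat_adjoint U * U) $$ (i, j) = 1\<^sub>m n $$ (i, j)"
        unfolding ent[OF ij] using * ij by simp
    qed (use assms in auto)
    with assms show "unitary_mat n U" by (rule unitary_matI)
  qed
qed

lemma diagonalized_by_iff:
  assumes M: "M \<in> carrier_mat n n"
  shows "diagonalized_by M U d \<longleftrightarrow> unitary_mat n U \<and>
    (\<forall>i<n. \<forall>j<n. M $$ (i, j) = (\<Sum>k<n. U $$ (i, k) * complex_of_real (d k) * cnj (U $$ (j, k))))"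
proof (cases "unitary_mat n U")
  case True
  let ?R = "U * mat_diag n (\<lambda>i. complex_of_real (d i)) * mat_adjoint U"
  have U: "U \<in> carrier_mat n n" using True by (rule unitary_matD)
  have ent: "?R $$ (i, j) = (\<Sum>k<n. U $$ (i, k) * complex_of_real (d k) * cnj (U $$ (j, k)))"
    if "i < n" "j < n" for i j
    using U that unfolding mat_diag_mult_right[OF U]
    by (simp add: scalar_prod_def atLeast0LessThan)
  have "M = ?R \<longleftrightarrow> (\<forall>i<n. \<forall>j<n. M $$ (i, j) = ?R $$ (i, j))"
  proof
    assume *: "\<forall>i<n. \<forall>j<n. M $$ (i, j) = ?R $$ (i, j)"
    show "M = ?R" by (rule eq_matI) (use M U * in auto)
  qed auto
  then show ?thesis using True M ent unfolding diagonalized_by_def by auto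
qed (use M in \<open>auto simp: diagonalized_by_def\<close>)

text \<open>Permuting columns together with eigenvalues only reorders the sum over eigenpairs; this
  is what allows the eigenvalues to be sorted.\<close>

lemma diagonalized_by_permute:
  assumes M: "M \<in> carrier_mat n n" "diagonalized_by M U d" and p: "p permutes {..<n}"
  shows "diagonalized_by M (mat n n (\<lambda>(i, j). U $$ (i, p j))) (d \<circ> p)"
proof -
  let ?V = "mat n n (\<lambda>(i, j). U $$ (i, p j))"
  have U: "unitary_mat n U" "U \<in> carrier_mat n n"
    using M unitary_matD[of n U] by (auto simp: diagonalized_by_def)
  have p_less: "p i < n" if "i < n" for i using permutes_in_image[OF p] that by auto
  have p_inj: "p i = p j \<longleftrightarrow> i = j" for i j using permutes_inj[OF p] by (auto simp: inj_def)
  have "(\<Sum>k<n. cnj (?V $$ (k, i)) * ?V $$ (k, j)) = (if i = j then 1 else 0)" if "i < n" "j < n" for i j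
    using that U(1)[unfolded unitary_mat_iff[OF U(2)]] p_less[of i] p_less[of j] p_inj[of i j] by simp
  moreover have "M $$ (i, j) = (\<Sum>k<n. ?V $$ (i, k) * complex_of_real ((d \<circ> p) k) * cnj (?V $$ (j, k)))"
    if "i < n" "j < n" for i j
  proof -
    have "M $$ (i, j) = (\<Sum>k<n. U $$ (i, k) * complex_of_real (d k) * cnj (U $$ (j, k)))"
      using M(2)[unfolded diagonalized_by_iff[OF M(1)]] that by auto
    also have "\<dots> = (\<Sum>k<n. U $$ (i, p k) * complex_of_real (d (p k)) * cnj (U $$ (j, p k)))"
      by (subst sum.permute[OF p]) (simp add: o_def)
    finally show ?thesis using that by simp
  qed
  ultimately show ?thesis
    unfolding diagonalized_by_iff[OF M(1)] by (auto simp: unitary_mat_iff[of ?V n])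
qed

text \<open>Complete \<open>v\<close> to a basis, apply Gram-Schmidt, which keeps the first vector,
  and normalize.\<close>

lemma unitary_mat_first_col:
  assumes v: "v \<in> carrier_vec n" "v \<noteq> 0\<^sub>v n" and n: "0 < n"
  obtains W c where "unitary_mat n W" "col W 0 = c \<cdot>\<^sub>v v"
proof -
  interpret cof_vec_space n "TYPE(complex)" .
  define ws where "ws = gram_schmidt n (basis_completion v)"
  note b = basis_completion[OF v]
  have ws: "set ws \<subseteq> carrier_vec n" "corthogonal ws" "length ws = n"
    using gram_schmidt_result[OF b(2,4,5) refl, folded ws_def] b(6) by auto
  have "hd ws = v"
    using gram_schmidt_hd[OF v(1), of "tl (basis_completion v)"] b(6,7) n
    unfolding ws_def by (cases "basis_completion v") auto
  then have ws0: "ws ! 0 = v" using ws(3) n by (metis hd_conv_nth length_greater_0_conv)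
  have car: "ws ! i \<in> carrier_vec n" if "i < n" for i using ws that by auto
  have orth: "(\<Sum>k<n. cnj (ws ! i $ k) * ws ! j $ k) = 0 \<longleftrightarrow> i \<noteq> j" if "i < n" "j < n" for i j
  proof -
    have "ws ! j \<bullet>c ws ! i = (\<Sum>k<n. cnj (ws ! i $ k) * ws ! j $ k)"
      using car[OF that(1)] car[OF that(2)] by (simp add: scalar_prod_def atLeast0LessThan mult.commute)
    then show ?thesis using corthogonalD[OF ws(2), of j i] that ws(3) by auto
  qed
  \<comment> \<open>The squared norms: the orthogonal vectors in \<open>ws\<close> still have to be
    divided by their lengths.\<close>
  define s where "s i = (\<Sum>k<n. (cmod (ws ! i $ k))\<^sup>2)" for i
  have s: "(\<Sum>k<n. cnj (ws ! i $ k) * ws ! i $ k) = complex_of_real (s i)" for i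
    by (simp add: s_def complex_norm_square mult.commute del: of_real_power)
  have s_pos: "0 < s i" if "i < n" for i
  proof -
    have "s i \<noteq> 0" using orth[OF that that] s[of i] by auto
    moreover have "0 \<le> s i" by (simp add: s_def sum_nonneg)
    ultimately show ?thesis by simp
  qed
  define W where "W = mat n n (\<lambda>(k, i). ws ! i $ k / complex_of_real (sqrt (s i)))"
  have W: "W \<in> carrier_mat n n" by (simp add: W_def)
  have "(\<Sum>k<n. cnj (W $$ (k, i)) * W $$ (k, j)) = (if i = j then 1 else 0)" if "i < n" "j < n" for i j
  proof -
    have "(\<Sum>k<n. cnj (W $$ (k, i)) * W $$ (k, j))
      = (\<Sum>k<n. cnj (ws ! i $ k) * ws ! j $ k) / complex_of_real (sqrt (s i) * sqrt (s j))"
      using that by (simp add: W_def sum_divide_distrib)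
    also have "\<dots> = (if i = j then 1 else 0)"
      using orth[OF that] s[of i] s_pos[OF that(1)] by (cases "i = j") (auto simp del: of_real_mult)
    finally show ?thesis .
  qed
  then have "unitary_mat n W" using unitary_mat_iff[OF W] by blast
  moreover have "col W 0 = (1 / complex_of_real (sqrt (s 0))) \<cdot>\<^sub>v v"
    by (rule eq_vecI) (use n W v ws0 in \<open>auto simp: W_def\<close>)
  ultimately show thesis by (rule that)
qed

lemma diagonalized_by_unitary_conj:
  assumes M: "M \<in> carrier_mat n n" and W: "unitary_mat n W"
    and d: "diagonalized_by (mat_adjoint W * M * W) U d"
  shows "diagonalized_by M (W * U) d"
proof -
  let ?D = "mat_diag n (\<lambda>i. complex_of_real (d i))"
  note w = unitary_matD[OF W]
  have U: "unitary_mat n U" and eq: "mat_adjoint W * M * W = U * ?D * mat_adjoint U"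
    using d w by (auto simp: diagonalized_by_def)
  note u = unitary_matD[OF U]
  have D: "?D \<in> carrier_mat n n" by simp
  note assoc = assoc_mult_mat[of _ n n _ n _ n] and car = mult_carrier_mat[of _ n n _ n]
  have "M = (W * mat_adjoint W) * M * (W * mat_adjoint W)" using M w by simp
  also have "\<dots> = W * (mat_adjoint W * M * W) * mat_adjoint W"
    using M w(1,2) by (simp add: assoc car)
  also have "\<dots> = W * U * ?D * (mat_adjoint U * mat_adjoint W)"
    unfolding eq using w(1,2) u(1,2) D by (simp add: assoc car)
  also have "mat_adjoint U * mat_adjoint W = mat_adjoint (W * U)"
    using w(1) u(1) by (simp add: mat_adjoint_mult[of _ n n])
  finally show ?thesis
    using unitary_mat_mult[OF W U] unfolding diagonalized_by_def carrier_matD(1)[OF M] by blast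
qed

text \<open>By symmetry the first row vanishes off the diagonal too, so \<open>M\<close> is the
  direct sum of a real scalar and the smaller block, and \<open>V\<close> is extended by a leading
  1.\<close>

lemma diagonalized_by_block:
  assumes M: "M \<in> carrier_mat (Suc m) (Suc m)" "hermitian_mat M"
    and M0: "\<And>i. 0 < i \<Longrightarrow> i < Suc m \<Longrightarrow> M $$ (i, 0) = 0"
    and V: "diagonalized_by (mat m m (\<lambda>(i, j). M $$ (Suc i, Suc j))) V d"
  shows "\<exists>U d. diagonalized_by M U d"
proof -
  define U where "U = mat (Suc m) (Suc m)
    (\<lambda>(i, j). if i = 0 \<or> j = 0 then if i = j then 1 else 0 else V $$ (i - 1, j - 1))"
  define e where "e = case_nat (Re (M $$ (0, 0))) d"
  have V': "unitary_mat m V" "V \<in> carrier_mat m m"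
    using V unitary_matD[of m V] by (auto simp: diagonalized_by_def)
  have U: "U \<in> carrier_mat (Suc m) (Suc m)" by (simp add: U_def)
  have U_simps: "U $$ (0, 0) = 1" "i < m \<Longrightarrow> U $$ (0, Suc i) = 0" "i < m \<Longrightarrow> U $$ (Suc i, 0) = 0"
    "i < m \<Longrightarrow> j < m \<Longrightarrow> U $$ (Suc i, Suc j) = V $$ (i, j)" for i j
    by (auto simp: U_def)
  have herm: "M $$ (i, j) = cnj (M $$ (j, i))" if "i < Suc m" "j < Suc m" for i j
    using M hermitian_mat_iff that by blast
  have M0': "M $$ (0, i) = 0" if "0 < i" "i < Suc m" for i
    using herm[of 0 i] M0 that by simp
  have real: "complex_of_real (Re (M $$ (0, 0))) = M $$ (0, 0)"
    using herm[of 0 0] by (simp add: complex_eq_iff)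
  have Vs: "(\<Sum>k<m. cnj (V $$ (k, i)) * V $$ (k, j)) = (if i = j then 1 else 0)"
    if "i < m" "j < m" for i j
    using V'(1)[unfolded unitary_mat_iff[OF V'(2)]] that by auto
  have Ms: "M $$ (Suc i, Suc j) = (\<Sum>k<m. V $$ (i, k) * complex_of_real (d k) * cnj (V $$ (j, k)))"
    if "i < m" "j < m" for i j
    using V[unfolded diagonalized_by_iff[OF mat_carrier]] that by auto
  have "(\<Sum>k<Suc m. cnj (U $$ (k, i)) * U $$ (k, j)) = (if i = j then 1 else 0)"
    if "i < Suc m" "j < Suc m" for i j
    using that Vs
    by (cases i; cases j) (auto simp: sum.lessThan_Suc_shift U_simps simp del: sum.lessThan_Suc)
  moreover have "M $$ (i, j) = (\<Sum>k<Suc m. U $$ (i, k) * complex_of_real (e k) * cnj (U $$ (j, k)))"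
    if "i < Suc m" "j < Suc m" for i j
    using that Ms M0 M0'
    by (cases i; cases j)
      (auto simp: sum.lessThan_Suc_shift U_simps e_def real simp del: sum.lessThan_Suc)
  ultimately have "diagonalized_by M U e"
    unfolding diagonalized_by_iff[OF M(1)] unitary_mat_iff[OF U] by blast
  then show ?thesis by blast
qed

text \<open>Deflation by induction on the dimension: the fundamental theorem of algebra yields an
  eigenvector, and conjugating by a unitary matrix with first column along it splits off a
  one-dimensional block.\<close>

theorem hermitian_mat_diagonalizable:
  assumes "M \<in> carrier_mat n n" "hermitian_mat M"
  shows "\<exists>U d. diagonalized_by M U d"
  using assms
proof (induction n arbitrary: M)
  case 0
  have "diagonalized_by M (1\<^sub>m 0) (\<lambda>_. 0)"
    using 0 by (auto simp: diagonalized_by_def unitary_mat_def intro!: eq_matI)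
  then show ?case by blast
next
  case (Suc m)
  let ?n = "Suc m"
  have "degree (char_poly M) \<noteq> 0" using degree_monic_char_poly[OF Suc.prems(1)] by simp
  then obtain e where "poly (char_poly M) e = 0"
    using fundamental_theorem_of_algebra[of "char_poly M"] by (auto simp: constant_degree)
  then obtain v where v: "v \<in> carrier_vec ?n" "v \<noteq> 0\<^sub>v ?n" "M *\<^sub>v v = e \<cdot>\<^sub>v v"
    using eigenvalue_root_char_poly[OF Suc.prems(1)] Suc.prems(1)
    by (auto simp: eigenvalue_def eigenvector_def)
  obtain W c where W: "unitary_mat ?n W" and c: "col W 0 = c \<cdot>\<^sub>v v"
    using unitary_mat_first_col[OF v(1,2)] by blast
  note w = unitary_matD[OF W]
  define N where "N = mat_adjoint W * M * W"
  have N: "N \<in> carrier_mat ?n ?n" using w(1,2) Suc.prems(1)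
    unfolding N_def by (intro mult_carrier_mat[of _ ?n ?n _ ?n])
  have "mat_adjoint N = mat_adjoint W * mat_adjoint (mat_adjoint W * M)"
    unfolding N_def using w(1,2) Suc.prems(1)
    by (intro mat_adjoint_mult[of _ ?n ?n _ ?n] mult_carrier_mat[of _ ?n ?n _ ?n])
  also have "mat_adjoint (mat_adjoint W * M) = mat_adjoint M * W"
    using w(1,2) Suc.prems(1) by (simp add: mat_adjoint_mult[of _ ?n ?n _ ?n])
  also have "mat_adjoint W * (mat_adjoint M * W) = N"
    using w(1,2) Suc.prems
    by (simp add: N_def hermitian_mat_def assoc_mult_mat[of _ ?n ?n _ ?n _ ?n])
  finally have hN: "hermitian_mat N" using N by (simp add: hermitian_mat_def)
  \<comment> \<open>The first column of \<open>N\<close> is \<open>e\<close> times the adjoint of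
    \<open>W\<close> applied to \<open>col W 0\<close>, hence \<open>e\<close> times the first unit
    vector.\<close>
  have "N $$ (i, 0) = 0" if "0 < i" "i < ?n" for i
  proof -
    have "M *\<^sub>v col W 0 = e \<cdot>\<^sub>v col W 0"
      using mult_mat_vec[OF Suc.prems(1) v(1), of c] v by (simp add: c smult_smult_assoc mult.commute)
    then have "col (M * W) 0 = e \<cdot>\<^sub>v col W 0"
      using Suc.prems(1) w by (simp only: col_mult2[of _ ?n ?n _ ?n] zero_less_Suc)
    then have "N $$ (i, 0) = row (mat_adjoint W) i \<bullet> (e \<cdot>\<^sub>v col W 0)"
      using w(1,2) Suc.prems(1) that by (simp add: N_def assoc_mult_mat[of _ ?n ?n _ ?n _ ?n])
    also have "\<dots> = e * (mat_adjoint W * W) $$ (i, 0)"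
      using w(1,2) that by simp
    also have "\<dots> = 0" using that by (simp add: w(3))
    finally show ?thesis .
  qed
  moreover have "hermitian_mat (mat m m (\<lambda>(i, j). N $$ (Suc i, Suc j)))"
    unfolding hermitian_mat_iff[OF mat_carrier]
  proof (intro allI impI)
    fix i j assume "i < m" "j < m"
    then show "mat m m (\<lambda>(i, j). N $$ (Suc i, Suc j)) $$ (i, j)
        = cnj (mat m m (\<lambda>(i, j). N $$ (Suc i, Suc j)) $$ (j, i))"
      using hN[unfolded hermitian_mat_iff[OF N], rule_format, of "Suc i" "Suc j"] by simp
  qed
  then obtain V d where "diagonalized_by (mat m m (\<lambda>(i, j). N $$ (Suc i, Suc j))) V d"
    using Suc.IH[OF mat_carrier] by blast
  ultimately obtain U d where "diagonalized_by N U d"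
    using diagonalized_by_block[OF N hN] by blast
  then show ?case using diagonalized_by_unitary_conj[OF Suc.prems(1) W] by (auto simp: N_def)
qed

lemma hermitian_mat_diagonalizable_desc:
  assumes "M \<in> carrier_mat n n" "hermitian_mat M"
  shows "\<exists>U d. diagonalized_by M U d \<and> (\<forall>i j. i \<le> j \<longrightarrow> j < n \<longrightarrow> d j \<le> d i)"
proof -
  obtain U d where d: "diagonalized_by M U d" using hermitian_mat_diagonalizable[OF assms] by blast
  define xs where "xs = map d [0..<n]"
  have "mset (rev (sort xs)) = mset xs" by simp
  then obtain p where p: "p permutes {..<length xs}" "permute_list p xs = rev (sort xs)"
    by (metis mset_eq_permutation)
  have len: "length xs = n" by (simp add: xs_def)
  have dp: "d (p i) = rev (sort xs) ! i" if "i < n" for i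
  proof -
    have "p i < n" using permutes_in_image[OF p(1)] that len by auto
    then show ?thesis
      using permute_list_nth[OF p(1), of i] that len p(2) by (simp add: xs_def)
  qed
  have "(d \<circ> p) j \<le> (d \<circ> p) i" if "i \<le> j" "j < n" for i j
    using that dp[of i] dp[of j] len
    by (auto simp: rev_nth intro!: sorted_nth_mono)
  with diagonalized_by_permute[OF assms(1) d p(1)[unfolded len]] show ?thesis by blast
qed

text \<open>Similarity to a diagonal matrix splits the characteristic polynomial into linear factors
  with the roots \<open>d i\<close>, and \<open>d\<close> is already in the required order.\<close>

lemma eigvals_desc_diagonalized:
  assumes M: "M \<in> carrier_mat n n" "diagonalized_by M U d"
    and dec: "\<And>i j. i \<le> j \<Longrightarrow> j < n \<Longrightarrow> d j \<le> d i"
  shows "eigvals_desc M = map d [0..<n]"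
proof -
  let ?D = "mat_diag n (\<lambda>i. complex_of_real (d i))"
  have U: "unitary_mat n U" "M = U * ?D * mat_adjoint U"
    using M by (auto simp: diagonalized_by_def)
  note u = unitary_matD[OF U(1)]
  have D: "?D \<in> carrier_mat n n" by simp
  have "similar_mat M ?D"
    using M(1) u U(2) D by (intro similar_matI[of _ _ U "mat_adjoint U" n]) auto
  then have "char_poly M = char_poly ?D" by (rule char_poly_similar)
  also have "\<dots> = (\<Prod>a\<leftarrow>diag_mat ?D. [:- a, 1:])"
    using D by (rule char_poly_upper_triangular) (auto simp: mat_diag_def)
  also have "diag_mat ?D = map (\<lambda>i. complex_of_real (d i)) [0..<n]"
    by (auto simp: diag_mat_def mat_diag_def)
  finally have "char_poly M = (\<Prod>p\<leftarrow>map (\<lambda>i. [:- complex_of_real (d i), 1:]) [0..<n]. p)"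
    by (simp add: o_def)
  then have "proots (char_poly M) = (\<Sum>p\<leftarrow>map (\<lambda>i. [:- complex_of_real (d i), 1:]) [0..<n]. proots p)"
    by (simp only:) (rule proots_prod_list, auto)
  also have "\<dots> = mset (map (\<lambda>i. complex_of_real (d i)) [0..<n])"
    by (induction n) (auto simp: o_def)
  finally have "image_mset Re (proots (char_poly M)) = mset (map d [0..<n])"
    by (simp add: image_mset.compositionality o_def flip: mset_map)
  then have "eigvals_desc M = rev (sort (map d [0..<n]))"
    by (simp only: eigvals_desc_def sorted_list_of_multiset_mset)
  also have "sort (map d [0..<n]) = rev (map d [0..<n])"
  proof (rule properties_for_sort)
    show "sorted (rev (map d [0..<n]))"
      unfolding sorted_iff_nth_mono by (auto simp: rev_nth intro!: dec)
  qed simp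
  finally show ?thesis by simp
qed

subsection \<open>Sums of the largest eigenvalues and their directional derivatives\<close>

text \<open>Weights in the unit interval with total \<open>k\<close> do best when concentrated on
  the \<open>k\<close> largest values.\<close>

lemma sum_weighted_le_sum_first:
  fixes d c :: "nat \<Rightarrow> real"
  assumes dec: "\<And>i j. i \<le> j \<Longrightarrow> j < n \<Longrightarrow> d j \<le> d i"
    and c: "\<And>i. i < n \<Longrightarrow> 0 \<le> c i" "\<And>i. i < n \<Longrightarrow> c i \<le> 1" "(\<Sum>i<n. c i) = real k"
    and k: "k \<le> n"
  shows "(\<Sum>i<n. d i * c i) \<le> (\<Sum>i<k. d i)"
proof (cases "k = 0")
  case True
  then have "c i = 0" if "i < n" for i
    using c that sum_nonneg_eq_0_iff[of "{..<n}" c] by auto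
  then show ?thesis using True by simp
next
  case False
  \<comment> \<open>The k-th largest value. Subtracting it makes the leading differences
    non-negative and the others non-positive, and it shifts both sides equally because the weights
    add up to \<open>k\<close>.\<close>
  define \<theta> where "\<theta> = d (k - 1)"
  have "d i * c i - \<theta> * c i \<le> (if i < k then d i - \<theta> else 0)" if i: "i < n" for i
  proof (cases "i < k")
    case True
    then have "(d i - \<theta>) * c i \<le> (d i - \<theta>) * 1"
      using dec[of i "k - 1"] k c(2)[OF i] by (intro mult_left_mono) (auto simp: \<theta>_def)
    then show ?thesis using True by (simp add: algebra_simps)
  next
    case out: False
    then have "(d i - \<theta>) * c i \<le> 0"
      using dec[of "k - 1" i] i c(1)[OF i] False by (intro mult_nonpos_nonneg) (auto simp: \<theta>_def)
    then show ?thesis using out by (simp add: algebra_simps)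
  qed
  then have "(\<Sum>i<n. d i * c i - \<theta> * c i) \<le> (\<Sum>i<n. if i < k then d i - \<theta> else 0)"
    by (intro sum_mono) auto
  also have "\<dots> = (\<Sum>i<k. d i - \<theta>)"
    using k by (intro sum.mono_neutral_cong_right) auto
  finally show ?thesis
    using c(3) by (simp add: sum_subtractf flip: sum_distrib_left)
qed

definition top_sum :: "nat \<Rightarrow> complex mat \<Rightarrow> real" where
  "top_sum k M = (\<Sum>j<k. eigvals_desc M ! j)"

lemma top_sum_diagonalized:
  assumes "M \<in> carrier_mat n n" "diagonalized_by M U d"
    and "\<And>i j. i \<le> j \<Longrightarrow> j < n \<Longrightarrow> d j \<le> d i" and "k \<le> n"
  shows "top_sum k M = (\<Sum>j<k. d j)"
proof -
  have "eigvals_desc M = map d [0..<n]" using assms(1-3) by (rule eigvals_desc_diagonalized)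
  then show ?thesis using assms(4) by (simp add: top_sum_def)
qed

text \<open>The attainment half of Ky Fan's principle: an ordered eigenbasis is an optimal
  frame.\<close>

lemma top_sum_attained:
  assumes M: "M \<in> carrier_mat n n" "hermitian_mat M" and k: "k \<le> n"
  obtains V where "unitary_mat n V" "top_sum k M = (\<Sum>j<k. qform M (col V j))"
proof -
  obtain U d where U: "diagonalized_by M U d" "\<And>i j. i \<le> j \<Longrightarrow> j < n \<Longrightarrow> d j \<le> d i"
    using hermitian_mat_diagonalizable_desc[OF M] by blast
  have "top_sum k M = (\<Sum>j<k. d j)" using M(1) U k by (rule top_sum_diagonalized)
  also have "\<dots> = (\<Sum>j<k. qform M (col U j))"
    using k qform_col_eigenvector[OF M(1) U(1)] by (intro sum.cong) auto
  finally have "top_sum k M = (\<Sum>j<k. qform M (col U j))" .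
  moreover have "unitary_mat n U" using U(1) M by (auto simp: diagonalized_by_def)
  ultimately show thesis by (rule that[rotated])
qed

text \<open>The upper bound in Ky Fan's principle. The weight \<open>c i\<close> is the squared
  length of the projection of the i-th eigenvector onto the span of the frame; it lies in the unit
  interval and the weights add up to \<open>k\<close>.\<close>

lemma qform_sum_le_top_sum:
  assumes M: "M \<in> carrier_mat n n" "hermitian_mat M" and V: "unitary_mat n V" and k: "k \<le> n"
  shows "(\<Sum>j<k. qform M (col V j)) \<le> top_sum k M"
proof -
  obtain U d where U: "diagonalized_by M U d" "\<And>i j. i \<le> j \<Longrightarrow> j < n \<Longrightarrow> d j \<le> d i"
    using hermitian_mat_diagonalizable_desc[OF M] by blast
  have uU: "unitary_mat n U" using U(1) M by (auto simp: diagonalized_by_def)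
  define c where "c i = (\<Sum>j<k. overlap U V i j)" for i
  have "(\<Sum>j<k. qform M (col V j)) = (\<Sum>j<k. \<Sum>i<n. d i * overlap U V i j)"
    using k unitary_matD[OF V] by (intro sum.cong qform_col[OF M(1) U(1)]) auto
  also have "\<dots> = (\<Sum>i<n. d i * c i)"
    unfolding c_def sum_distrib_left by (rule sum.swap)
  also have "\<dots> \<le> (\<Sum>i<k. d i)"
  proof (rule sum_weighted_le_sum_first[OF U(2) _ _ _ k])
    fix i assume i: "i < n"
    have "c i \<le> (\<Sum>j<n. overlap U V i j)"
      unfolding c_def using k by (intro sum_mono2) auto
    then show "c i \<le> 1" using sum_overlap_right[OF uU V i] by simp
  next
    have "(\<Sum>i<n. c i) = (\<Sum>j<k. \<Sum>i<n. overlap U V i j)"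
      unfolding c_def by (rule sum.swap)
    also have "\<dots> = real k" using k sum_overlap_left[OF uU V] by simp
    finally show "(\<Sum>i<n. c i) = real k" .
  qed (auto simp: c_def sum_nonneg)
  also have "\<dots> = top_sum k M" using M(1) U k by (rule top_sum_diagonalized[symmetric])
  finally show ?thesis .
qed

lemma qform_add_smult:
  assumes "M \<in> carrier_mat n n" "N \<in> carrier_mat n n" "v \<in> carrier_vec n"
  shows "qform (M + complex_of_real t \<cdot>\<^sub>m N) v = qform M v + t * qform N v"
  using assms qform_add[of M n "complex_of_real t \<cdot>\<^sub>m N" v] qform_smult[of N n v t] by simp

text \<open>Convexity along the ray: a frame that is optimal at \<open>s\<close> gives an affine
  function of the parameter that touches \<open>top_sum\<close> at \<open>s\<close> and stays below
  it at 0 and at \<open>t\<close>.\<close>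

lemma top_sum_slope_mono:
  assumes Y: "Y \<in> carrier_mat n n" "hermitian_mat Y" and X: "X \<in> carrier_mat n n" "hermitian_mat X"
    and k: "k \<le> n" and st: "0 < s" "s \<le> t"
  shows "(top_sum k (Y + complex_of_real s \<cdot>\<^sub>m X) - top_sum k Y) / s
    \<le> (top_sum k (Y + complex_of_real t \<cdot>\<^sub>m X) - top_sum k Y) / t"
proof -
  let ?Z = "\<lambda>t. Y + complex_of_real t \<cdot>\<^sub>m X"
  have Z: "?Z t \<in> carrier_mat n n" "hermitian_mat (?Z t)" for t
    using X Y hermitian_mat_smult[OF X] by (auto intro!: hermitian_mat_add)
  obtain V where V: "unitary_mat n V" "top_sum k (?Z s) = (\<Sum>j<k. qform (?Z s) (col V j))"
    using top_sum_attained[OF Z k] .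
  define y where "y = (\<Sum>j<k. qform Y (col V j))"
  define x where "x = (\<Sum>j<k. qform X (col V j))"
  have sum: "(\<Sum>j<k. qform (?Z t) (col V j)) = y + t * x" for t
  proof -
    have "qform (?Z t) (col V j) = qform Y (col V j) + t * qform X (col V j)" if "j < k" for j
      using that k col_carrier_vec[OF _ unitary_matD(1)[OF V(1)], of j] X(1) Y(1)
      by (intro qform_add_smult[of _ n]) auto
    then show ?thesis by (simp add: y_def x_def sum.distrib sum_distrib_left)
  qed
  have "y \<le> top_sum k Y" unfolding y_def by (rule qform_sum_le_top_sum[OF Y V(1) k])
  moreover have "y + t * x \<le> top_sum k (?Z t)"
    using qform_sum_le_top_sum[OF Z V(1) k, of t] sum[of t] by simp
  \<comment> \<open>This writes \<open>s\<close> as a convex combination of 0 and \<open>t\<close>,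
    multiplied through by \<open>t\<close>.\<close>
  ultimately have "(t - s) * y + s * (y + t * x) \<le> (t - s) * top_sum k Y + s * top_sum k (?Z t)"
    using st by (intro add_mono mult_left_mono) auto
  then have "t * top_sum k (?Z s) \<le> (t - s) * top_sum k Y + s * top_sum k (?Z t)"
    unfolding V(2) sum by (simp add: algebra_simps)
  then show ?thesis using st by (simp add: field_simps)
qed

text \<open>The ordered eigenbasis of \<open>Y\<close> is optimal for \<open>Y\<close> and remains
  an admissible frame for the perturbed matrix.\<close>

lemma top_sum_slope_ge:
  assumes Y: "Y \<in> carrier_mat n n" and X: "X \<in> carrier_mat n n" "hermitian_mat X"
    and V: "diagonalized_by Y V l" "\<And>i j. i \<le> j \<Longrightarrow> j < n \<Longrightarrow> l j \<le> l i"
    and hY: "hermitian_mat Y" and k: "k \<le> n" and t: "0 < t"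
  shows "(\<Sum>j<k. qform X (col V j)) \<le> (top_sum k (Y + complex_of_real t \<cdot>\<^sub>m X) - top_sum k Y) / t"
proof -
  let ?Z = "Y + complex_of_real t \<cdot>\<^sub>m X"
  have Z: "?Z \<in> carrier_mat n n" "hermitian_mat ?Z"
    using X Y hY hermitian_mat_smult[OF X] by (auto intro!: hermitian_mat_add)
  have uV: "unitary_mat n V" using V Y by (auto simp: diagonalized_by_def)
  have "qform ?Z (col V j) = l j + t * qform X (col V j)" if "j < k" for j
  proof -
    have j: "j < n" using that k by simp
    have "col V j \<in> carrier_vec n" using j unitary_matD(1)[OF uV] by (rule col_carrier_vec)
    from qform_add_smult[OF Y X(1) this, of t] show ?thesis
      unfolding qform_col_eigenvector[OF Y V(1) j] .
  qed
  moreover have "top_sum k Y = (\<Sum>j<k. l j)" using Y V k by (rule top_sum_diagonalized)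
  ultimately have "(\<Sum>j<k. qform ?Z (col V j)) = top_sum k Y + t * (\<Sum>j<k. qform X (col V j))"
    by (simp add: sum.distrib sum_distrib_left)
  then have "top_sum k Y + t * (\<Sum>j<k. qform X (col V j)) \<le> top_sum k ?Z"
    using qform_sum_le_top_sum[OF Z uV k] by simp
  then show ?thesis using t by (simp add: field_simps)
qed

section \<open>Existence of the one-sided derivatives\<close>

lemma mono_bounded_tendsto_at_right:
  fixes \<phi> :: "real \<Rightarrow> real"
  assumes mono: "\<And>s t. 0 < s \<Longrightarrow> s \<le> t \<Longrightarrow> \<phi> s \<le> \<phi> t" and b: "\<And>t. 0 < t \<Longrightarrow> b \<le> \<phi> t"
  shows "(\<phi> \<longlongrightarrow> Inf (\<phi> ` {0<..})) (at_right 0)"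
proof (rule order_tendstoI)
  have bdd: "bdd_below (\<phi> ` {0<..})" using b by (auto intro!: bdd_belowI[of _ b])
  fix a
  {
    assume a: "a < Inf (\<phi> ` {0<..})"
    have "a < \<phi> t" if "0 < t" for t
      using cInf_lower[OF _ bdd, of "\<phi> t"] that a by force
    then show "\<forall>\<^sub>F t in at_right 0. a < \<phi> t"
      by (auto simp: eventually_at_right_field intro!: exI[of _ 1])
  next
    assume "Inf (\<phi> ` {0<..}) < a"
    then obtain s where s: "0 < s" "\<phi> s < a"
      using cInf_lessD[of "\<phi> ` {0<..}" a] by auto
    have "\<phi> t < a" if "0 < t" "t < s" for t using mono[of t s] that s by simp
    then show "\<forall>\<^sub>F t in at_right 0. \<phi> t < a"
      using s by (auto simp: eventually_at_right_field intro!: exI[of _ s])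
  }
qed

lemma is_delta_iff:
  assumes "Y \<in> carrier_mat n n"
  shows "is_delta X Y d \<longleftrightarrow> d \<in> carrier_vec n \<and>
    (\<forall>k\<in>{1..n}. ((\<lambda>t. (top_sum k (Y + complex_of_real t \<cdot>\<^sub>m X) - top_sum k Y) / t)
      \<longlongrightarrow> (\<Sum>j<k. d $ j)) (at_right 0))"
  using assms by (simp add: is_delta_def top_sum_def sum_subtractf)

text \<open>Existence, without which the definite description behind \<open>delta\<close> would say
  nothing: the monotone slopes converge, and the entries are the consecutive differences of their
  limits.\<close>

lemma is_delta_delta:
  assumes Y: "Y \<in> carrier_mat n n" "hermitian_mat Y" and X: "X \<in> carrier_mat n n" "hermitian_mat X"
  shows "is_delta X Y (delta X Y)"
proof -
  obtain V l where V: "diagonalized_by Y V l" "\<And>i j. i \<le> j \<Longrightarrow> j < n \<Longrightarrow> l j \<le> l i"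
    using hermitian_mat_diagonalizable_desc[OF Y] by blast
  let ?\<phi> = "\<lambda>k t. (top_sum k (Y + complex_of_real t \<cdot>\<^sub>m X) - top_sum k Y) / t"
  define L where "L k = Inf (?\<phi> k ` {0<..})" for k
  have lim: "(?\<phi> k \<longlongrightarrow> L k) (at_right 0)" if "k \<le> n" for k
    unfolding L_def
    by (rule mono_bounded_tendsto_at_right[OF top_sum_slope_mono[OF Y X that]
          top_sum_slope_ge[OF Y(1) X V Y(2) that]])
  \<comment> \<open>The empty sum has limit 0, so the telescoping starts correctly.\<close>
  have L0: "L 0 = 0" by (simp add: L_def top_sum_def)
  have "(\<Sum>j<k. vec n (\<lambda>j. L (Suc j) - L j) $ j) = L k" if "k \<le> n" for k
    using that L0 by (simp add: sum_lessThan_telescope)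
  then have "is_delta X Y (vec n (\<lambda>j. L (Suc j) - L j))"
    using lim by (simp add: is_delta_iff[OF Y(1)])
  then show ?thesis using delta_eqI by metis
qed

section \<open>Functional calculus and positivity in an eigenbasis\<close>

lemma diagonalized_by_hermitian:
  assumes M: "M \<in> carrier_mat n n" "diagonalized_by M U d"
  shows "hermitian_mat M"
  unfolding hermitian_mat_iff[OF M(1)]
  using M(2)[unfolded diagonalized_by_iff[OF M(1)]] by (simp add: mult.commute mult.left_commute)

lemma diagonalized_by_fun_calc:
  assumes M: "M \<in> carrier_mat n n" "diagonalized_by M U d"
  shows "fun_calc f M \<in> carrier_mat n n" "diagonalized_by (fun_calc f M) U (\<lambda>i. f (d i))"
    "hermitian_mat (fun_calc f M)"
proof -
  have U: "unitary_mat n U" using M by (auto simp: diagonalized_by_def)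
  note u = unitary_matD[OF U]
  note eq = fun_calc_eqI[OF M(2), of f, unfolded carrier_matD(1)[OF M(1)]]
  show car: "fun_calc f M \<in> carrier_mat n n"
    unfolding eq using u(1,2) by (intro mult_carrier_mat[of _ n n _ n]) auto
  show dia: "diagonalized_by (fun_calc f M) U (\<lambda>i. f (d i))"
    unfolding diagonalized_by_def carrier_matD(1)[OF car] using U eq by blast
  show "hermitian_mat (fun_calc f M)" using diagonalized_by_hermitian[OF car dia] .
qed

lemma diagonalized_by_add_smult:
  assumes M: "M \<in> carrier_mat n n" "diagonalized_by M U d"
    and N: "N \<in> carrier_mat n n" "diagonalized_by N U e"
  shows "diagonalized_by (M + complex_of_real t \<cdot>\<^sub>m N) U (\<lambda>i. d i + t * e i)"
proof -
  let ?S = "M + complex_of_real t \<cdot>\<^sub>m N"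
  have S: "?S \<in> carrier_mat n n" using M N by simp
  have "?S $$ (i, j) = (\<Sum>k<n. U $$ (i, k) * complex_of_real (d k + t * e k) * cnj (U $$ (j, k)))"
    if ij: "i < n" "j < n" for i j
  proof -
    have "M $$ (i, j) = (\<Sum>k<n. U $$ (i, k) * complex_of_real (d k) * cnj (U $$ (j, k)))"
      using M(2)[unfolded diagonalized_by_iff[OF M(1)]] ij by blast
    moreover have "N $$ (i, j) = (\<Sum>k<n. U $$ (i, k) * complex_of_real (e k) * cnj (U $$ (j, k)))"
      using N(2)[unfolded diagonalized_by_iff[OF N(1)]] ij by blast
    moreover have "?S $$ (i, j) = M $$ (i, j) + complex_of_real t * N $$ (i, j)"
      using M(1) N(1) ij by simp
    ultimately show ?thesis
      by (simp only: sum_distrib_left sum.distrib[symmetric]) (simp add: algebra_simps)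
  qed
  then show ?thesis
    using M unfolding diagonalized_by_iff[OF S] diagonalized_by_iff[OF M(1)] by blast
qed

lemma psd_mat_qform_nonneg:
  assumes "A \<in> carrier_mat n n" "psd_mat A" "x \<in> carrier_vec n"
  shows "0 \<le> qform A x"
  using assms by (simp add: psd_mat_def qform_def)

lemma psd_mat_eigenvalues_nonneg:
  assumes "A \<in> carrier_mat n n" "psd_mat A" "diagonalized_by A U a" "i < n"
  shows "0 \<le> a i"
proof -
  have "U \<in> carrier_mat n n" using assms by (auto simp: diagonalized_by_def unitary_mat_def)
  then show ?thesis
    using psd_mat_qform_nonneg[OF assms(1,2), of "col U i"] col_carrier_vec[of i n U n]
      qform_col_eigenvector[OF assms(1,3,4)] assms(4) by simp
qed

section \<open>Partial sums of the two vectors\<close>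

text \<open>The perturbation by \<open>fun_calc f C\<close> keeps the eigenbasis and turns
  \<open>l j\<close> into \<open>l j + t * f (l j)\<close>. As \<open>f\<close> is non-decreasing,
  the order survives and the slopes do not depend on \<open>t\<close>.\<close>

lemma delta_fun_calc_sum:
  assumes C: "C \<in> carrier_mat n n" "diagonalized_by C V l"
    and dec: "\<And>i j. i \<le> j \<Longrightarrow> j < n \<Longrightarrow> l j \<le> l i" and l: "\<And>j. j < n \<Longrightarrow> 0 \<le> l j"
    and f: "concave_on {0..} f" "\<And>x. 0 \<le> x \<Longrightarrow> 0 \<le> f x"
    and k: "k \<in> {1..n}"
  shows "(\<Sum>j<k. delta (fun_calc f C) C $ j) = (\<Sum>j<k. f (l j))"
proof -
  note fC = diagonalized_by_fun_calc[OF C, of f]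
  let ?\<phi> = "\<lambda>t. (top_sum k (C + complex_of_real t \<cdot>\<^sub>m fun_calc f C) - top_sum k C) / t"
  have "(?\<phi> \<longlongrightarrow> (\<Sum>j<k. delta (fun_calc f C) C $ j)) (at_right 0)"
    using is_delta_delta[OF C(1) diagonalized_by_hermitian[OF C] fC(1,3)] k
    by (simp add: is_delta_iff[OF C(1)])
  moreover have "?\<phi> t = (\<Sum>j<k. f (l j))" if t: "0 < t" for t
  proof -
    have "f (l j) \<le> f (l i)" if "i \<le> j" "j < n" for i j
      using l[OF that(2)] dec[OF that] by (intro concave_nonneg_mono[OF f])
    then have dec': "l j + t * f (l j) \<le> l i + t * f (l i)" if "i \<le> j" "j < n" for i j
      using dec[OF that] that t by (intro add_mono mult_left_mono) auto
    have kn: "k \<le> n" using k by simp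
    have "C + complex_of_real t \<cdot>\<^sub>m fun_calc f C \<in> carrier_mat n n" using C fC by simp
    from this diagonalized_by_add_smult[OF C fC(1,2)] dec' kn
    have "top_sum k (C + complex_of_real t \<cdot>\<^sub>m fun_calc f C) = (\<Sum>j<k. l j + t * f (l j))"
      by (rule top_sum_diagonalized)
    moreover have "top_sum k C = (\<Sum>j<k. l j)"
      using C dec kn by (rule top_sum_diagonalized)
    ultimately show ?thesis using t by (simp add: sum.distrib flip: sum_distrib_left)
  qed
  then have "\<forall>\<^sub>F t in at_right 0. ?\<phi> t = (\<Sum>j<k. f (l j))"
    by (rule eventually_mono[OF eventually_at_right_less])
  then have "(?\<phi> \<longlongrightarrow> (\<Sum>j<k. f (l j))) (at_right 0)"
    by (rule tendsto_eventually)
  ultimately show ?thesis by (rule tendsto_unique[OF trivial_limit_at_right_real])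
qed

text \<open>The bound on the slopes given by the eigenbasis of \<open>Y\<close> passes to the
  limit.\<close>

lemma delta_sum_ge:
  assumes Y: "Y \<in> carrier_mat n n" "diagonalized_by Y V l"
    and dec: "\<And>i j. i \<le> j \<Longrightarrow> j < n \<Longrightarrow> l j \<le> l i"
    and X: "X \<in> carrier_mat n n" "hermitian_mat X" and k: "k \<in> {1..n}"
  shows "(\<Sum>j<k. qform X (col V j)) \<le> (\<Sum>j<k. delta X Y $ j)"
proof (rule tendsto_lowerbound)
  note hY = diagonalized_by_hermitian[OF Y]
  show "((\<lambda>t. (top_sum k (Y + complex_of_real t \<cdot>\<^sub>m X) - top_sum k Y) / t)
      \<longlongrightarrow> (\<Sum>j<k. delta X Y $ j)) (at_right 0)"
    using is_delta_delta[OF Y(1) hY X] k by (simp add: is_delta_iff[OF Y(1)])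
  show "\<forall>\<^sub>F t in at_right 0. (\<Sum>j<k. qform X (col V j))
      \<le> (top_sum k (Y + complex_of_real t \<cdot>\<^sub>m X) - top_sum k Y) / t"
  proof (rule eventually_mono[OF eventually_at_right_less])
    fix t :: real assume t: "0 < t"
    have "k \<le> n" using k by simp
    with Y(1) X Y(2) dec hY
    show "(\<Sum>j<k. qform X (col V j)) \<le> (top_sum k (Y + complex_of_real t \<cdot>\<^sub>m X) - top_sum k Y) / t"
      using t by (rule top_sum_slope_ge)
  qed
qed simp

theorem proposition4:
  fixes n :: nat and A B :: "complex mat" and f :: "real \<Rightarrow> real"
  assumes "A \<in> carrier_mat n n" and "B \<in> carrier_mat n n"
    and "psd_mat A" and "psd_mat B"
    and "\<And>x. 0 \<le> x \<Longrightarrow> 0 \<le> f x"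
    and "concave_on {0..} f"
    and "f 0 = 0"
  shows "delta (fun_calc f (A + B)) (A + B) \<prec>\<^sub>w delta (fun_calc f A + fun_calc f B) (A + B)"
proof -
  define C where "C = A + B"
  have C: "C \<in> carrier_mat n n" using assms by (simp add: C_def)
  have hA: "hermitian_mat A" and hB: "hermitian_mat B" using assms by (auto simp: psd_mat_def)
  then have hC: "hermitian_mat C" using assms(1,2) by (simp add: C_def hermitian_mat_add)
  obtain U a where U: "diagonalized_by A U a" using hermitian_mat_diagonalizable[OF assms(1) hA] by blast
  obtain W b where W: "diagonalized_by B W b" using hermitian_mat_diagonalizable[OF assms(2) hB] by blast
  obtain V l where V: "diagonalized_by C V l" and dec: "\<And>i j. i \<le> j \<Longrightarrow> j < n \<Longrightarrow> l j \<le> l i"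
    using hermitian_mat_diagonalizable_desc[OF C hC] by blast
  have V': "V \<in> carrier_mat n n" using V C by (auto simp: diagonalized_by_def unitary_mat_def)
  have colV: "col V j \<in> carrier_vec n" if "j < n" for j using V' that by simp
  have qC: "qform C x = qform A x + qform B x" if "x \<in> carrier_vec n" for x
    unfolding C_def using assms(1,2) that by (rule qform_add)
  have qA0: "0 \<le> qform A x" and qB0: "0 \<le> qform B x" if "x \<in> carrier_vec n" for x
    using psd_mat_qform_nonneg that assms by blast+
  have a: "0 \<le> a i" and b: "0 \<le> b i" if "i < n" for i
    using psd_mat_eigenvalues_nonneg that assms U W by blast+
  have ql: "qform A (col V j) + qform B (col V j) = l j" if "j < n" for j
    using qform_col_eigenvector[OF C V that] qC[OF colV[OF that]] by simp
  have l: "0 \<le> l j" if "j < n" for j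
    using ql[OF that] qA0[OF colV[OF that]] qB0[OF colV[OF that]] by simp
  have leA: "qform A x \<le> qform C x" and leB: "qform B x \<le> qform C x" if "x \<in> carrier_vec n" for x
    using qA0[OF that] qB0[OF that] qC[OF that] by simp_all
  note fA = diagonalized_by_fun_calc[OF assms(1) U, of f]
  note fB = diagonalized_by_fun_calc[OF assms(2) W, of f]
  note fC = diagonalized_by_fun_calc[OF C V, of f]
  define X where "X = fun_calc f A + fun_calc f B"
  have X: "X \<in> carrier_mat n n" "hermitian_mat X"
    using fA fB by (auto simp: X_def intro: hermitian_mat_add)
  have dims: "delta (fun_calc f C) C \<in> carrier_vec n" "delta X C \<in> carrier_vec n"
    using is_delta_delta[OF C hC fC(1,3)] is_delta_delta[OF C hC X] by (auto simp: is_delta_iff[OF C])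
  have "(\<Sum>j<k. delta (fun_calc f C) C $ j) \<le> (\<Sum>j<k. delta X C $ j)" if k: "k \<in> {1..n}" for k
  proof -
    have kn: "k \<le> n" using k by simp
    \<comment> \<open>The forms of \<open>A\<close> and \<open>B\<close> add up to
      \<open>l j\<close>; for \<open>l j = 0\<close> both sides are 0 because
      \<open>f 0 = 0\<close>.\<close>
    have "f (l j) = f (l j) / l j * qform A (col V j) + f (l j) / l j * qform B (col V j)" if "j < n" for j
      unfolding distrib_left[symmetric] ql[OF that] by (simp add: assms(7))
    then have "(\<Sum>j<k. f (l j)) =
      (\<Sum>j<k. f (l j) / l j * qform A (col V j)) + (\<Sum>j<k. f (l j) / l j * qform B (col V j))"
      unfolding sum.distrib[symmetric] using kn by (intro sum.cong) auto
    \<comment> \<open>Both summands are dominated by \<open>C\<close>, so the partial trace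
      inequality applies to each of them.\<close>
    also have "\<dots> \<le> (\<Sum>j<k. \<Sum>i<n. f (a i) * overlap U V i j) + (\<Sum>j<k. \<Sum>i<n. f (b i) * overlap W V i j)"
      by (intro add_mono concave_partial_sum_dominated[OF assms(1) U C V a l dec leA assms(6,7,5) kn]
          concave_partial_sum_dominated[OF assms(2) W C V b l dec leB assms(6,7,5) kn])
    also have "\<dots> = (\<Sum>j<k. (\<Sum>i<n. f (a i) * overlap U V i j) + (\<Sum>i<n. f (b i) * overlap W V i j))"
      by (rule sum.distrib[symmetric])
    also have "\<dots> = (\<Sum>j<k. qform X (col V j))"
    proof (rule sum.cong)
      fix j assume "j \<in> {..<k}"
      then have j: "j < n" using kn by simp
      show "(\<Sum>i<n. f (a i) * overlap U V i j) + (\<Sum>i<n. f (b i) * overlap W V i j) = qform X (col V j)"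
        unfolding X_def qform_add[OF fA(1) fB(1) colV[OF j]] qform_col[OF fA(1,2) V' j]
          qform_col[OF fB(1,2) V' j] ..
    qed (rule refl)
    also have "\<dots> \<le> (\<Sum>j<k. delta X C $ j)"
      using C V dec X k by (rule delta_sum_ge)
    finally have "(\<Sum>j<k. f (l j)) \<le> (\<Sum>j<k. delta X C $ j)" .
    moreover have "(\<Sum>j<k. delta (fun_calc f C) C $ j) = (\<Sum>j<k. f (l j))"
      using C V dec l assms(6,5) k by (rule delta_fun_calc_sum)
    ultimately show ?thesis by simp
  qed
  then show ?thesis
    unfolding partial_sums_le_def C_def[symmetric] X_def[symmetric] using dims by simp
qed

end
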